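(* Let $M=\mathbf{R}$, $S^1$, or $I$. Then every finitely-generated, torsion-free nilpotent group is isomorphic to a subgroup of $\mathrm{Diff}^1(M)$.
   Context: $I=[0,1]$, $S^1$ is the circle, $\mathbf{R}$ is the real line. $\mathrm{Diff}^1(M)$ denotes the group of orientation-preserving $C^1$ diffeomorphisms of $M$ (differentiability is understood up to and including boundary points of $M$), under composition. *)

theory Defs
  imports "HOL-Analysis.Analysis" "HOL-Algebra.Bij" "HOL-Algebra.Generated_Groups"
begin

section \<open>Finitely generated, torsion-free and nilpotent groups\<close>

definition finitely_generated_group :: "('a, 'b) monoid_scheme \<Rightarrow> bool" where
  "finitely_generated_group G \<longleftrightarrow>
     group G \<and> (\<exists>A. finite A \<and> A \<subseteq> carrier G \<and> generate G A = carrier G)"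

definition torsion_free_group :: "('a, 'b) monoid_scheme \<Rightarrow> bool" where
  "torsion_free_group G \<longleftrightarrow>
     group G \<and> (\<forall>x\<in>carrier G. \<forall>n::nat. 0 < n \<longrightarrow> x [^]\<^bsub>G\<^esub> n = \<one>\<^bsub>G\<^esub> \<longrightarrow> x = \<one>\<^bsub>G\<^esub>)"

primrec lower_central_series :: "('a, 'b) monoid_scheme \<Rightarrow> nat \<Rightarrow> 'a set" where
  "lower_central_series G 0 = carrier G"
| "lower_central_series G (Suc n) =
     generate G (\<Union>x\<in>lower_central_series G n. \<Union>y\<in>carrier G.
       {x \<otimes>\<^bsub>G\<^esub> y \<otimes>\<^bsub>G\<^esub> inv\<^bsub>G\<^esub> x \<otimes>\<^bsub>G\<^esub> inv\<^bsub>G\<^esub> y})"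

definition nilpotent_group :: "('a, 'b) monoid_scheme \<Rightarrow> bool" where
  "nilpotent_group G \<longleftrightarrow> group G \<and> (\<exists>n. lower_central_series G n = {\<one>\<^bsub>G\<^esub>})"


section \<open>The groups of orientation-preserving diffeomorphisms\<close>

text \<open>
  The derivative is taken within \<open>S\<close>, so it is one-sided at an endpoint of a compact interval.
  (The library's \<open>C1_differentiable_on\<close> uses two-sided derivatives and hence depends on the
  values outside \<open>S\<close>.)
\<close>
definition C1_within :: "(real \<Rightarrow> 'a::real_normed_vector) \<Rightarrow> real set \<Rightarrow> bool" where
  "C1_within f S \<longleftrightarrow>
     (\<exists>f'. (\<forall>x\<in>S. (f has_vector_derivative f' x) (at x within S)) \<and> continuous_on S f')"

text \<open>
  As in \<open>BijGroup\<close>, a self-map of \<open>M\<close> is represented by the function that is \<open>undefined\<close>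
  outside \<open>M\<close>, so that maps which agree on \<open>M\<close> are equal.
\<close>
definition Diff1_real_carrier :: "real set \<Rightarrow> (real \<Rightarrow> real) set" where
  "Diff1_real_carrier S = {f \<in> Bij S. C1_within f S \<and> C1_within (inv_into S f) S \<and>
     (\<forall>x\<in>S. \<exists>d>0. (f has_real_derivative d) (at x within S))}"

definition Diff1_real :: "real set \<Rightarrow> (real \<Rightarrow> real) monoid" where
  "Diff1_real S = BijGroup S \<lparr>carrier := Diff1_real_carrier S\<rparr>"

abbreviation Diff1_line :: "(real \<Rightarrow> real) monoid" where
  "Diff1_line \<equiv> Diff1_real UNIV"

abbreviation Diff1_interval :: "(real \<Rightarrow> real) monoid" where
  "Diff1_interval \<equiv> Diff1_real {0..1}"

abbreviation circle :: "complex set" where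
  "circle \<equiv> sphere 0 1"

text \<open>
  The circle is the unit circle of the complex plane. Since \<open>cis\<close> is a smooth covering
  (a local diffeomorphism) of the circle by the line, and the circle is an embedded submanifold
  of the plane, a self-map \<open>f\<close> of the circle is \<open>C\<^sup>1\<close> iff \<open>f \<circ> cis\<close> is a \<open>C\<^sup>1\<close> curve in the plane.
\<close>
definition C1_circle :: "(complex \<Rightarrow> complex) \<Rightarrow> bool" where
  "C1_circle f \<longleftrightarrow> C1_within (\<lambda>t. f (cis t)) UNIV"

text \<open>
  The tangent line of the circle at \<open>z\<close> is oriented by the vector \<open>\<i> * z\<close>, which at \<open>z = cis t\<close> is
  the velocity of \<open>cis\<close>. The last conjunct says that the differential of \<open>f\<close> at \<open>cis t\<close> sends this
  vector to a positive multiple of \<open>\<i> * f (cis t)\<close>.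
\<close>
definition Diff1_circle_carrier :: "(complex \<Rightarrow> complex) set" where
  "Diff1_circle_carrier = {f \<in> Bij circle. C1_circle f \<and> C1_circle (inv_into circle f) \<and>
     (\<forall>t. \<exists>d>0. ((\<lambda>s. f (cis s)) has_vector_derivative (d *\<^sub>R (\<i> * f (cis t)))) (at t))}"

definition Diff1_circle :: "(complex \<Rightarrow> complex) monoid" where
  "Diff1_circle = BijGroup circle \<lparr>carrier := Diff1_circle_carrier\<rparr>"


section \<open>They are groups\<close>

lemma BijGroup_subgroupI:
  assumes "X \<subseteq> Bij S" "(\<lambda>x\<in>S. x) \<in> X"
    and c: "\<And>f g. f \<in> X \<Longrightarrow> g \<in> X \<Longrightarrow> compose S f g \<in> X"
    and i: "\<And>f. f \<in> X \<Longrightarrow> restrict (inv_into S f) S \<in> X"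
  shows "group (BijGroup S \<lparr>carrier := X\<rparr>)"
proof -
  interpret group "BijGroup S" by (rule group_BijGroup)
  have "subgroup X (BijGroup S)"
  proof
    show "inv\<^bsub>BijGroup S\<^esub> f \<in> X" if "f \<in> X" for f
      using that assms(1) i inv_BijGroup by fastforce
  qed (use assms in \<open>auto simp: BijGroup_def\<close>)
  then show ?thesis by (rule subgroup.subgroup_is_group) (rule group_BijGroup)
qed

lemma C1_within_cong:
  assumes "\<And>x. x \<in> S \<Longrightarrow> f x = g x"
  shows "C1_within f S \<longleftrightarrow> C1_within g S"
  unfolding C1_within_def
proof (intro ex_cong1 conj_cong ball_cong refl)
  fix f' x assume "x \<in> S"
  then show "(f has_vector_derivative f' x) (at x within S) \<longleftrightarrow> (g has_vector_derivative f' x) (at x within S)"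
    using has_vector_derivative_transform[of x S f g] has_vector_derivative_transform[of x S g f] assms
    by metis
qed

lemma real_derivative_transform:
  assumes "x \<in> S" "\<And>y. y \<in> S \<Longrightarrow> g y = f y" "(f has_real_derivative d) (at x within S)"
  shows "(g has_real_derivative d) (at x within S)"
  using assms has_vector_derivative_transform[of x S g f d]
  by (simp add: has_real_derivative_iff_has_vector_derivative)

lemma C1_within_compose:
  assumes "C1_within f S" "C1_within g S" "g ` S \<subseteq> S"
  shows "C1_within (\<lambda>x. f (g x)) S"
proof -
  obtain f' g' where f: "\<And>x. x\<in>S \<Longrightarrow> (f has_vector_derivative f' x) (at x within S)" "continuous_on S f'"
    and g: "\<And>x. x\<in>S \<Longrightarrow> (g has_vector_derivative g' x) (at x within S)" "continuous_on S g'"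
    using assms unfolding C1_within_def by metis
  have cg: "continuous_on S g"
    using g(1) has_vector_derivative_continuous continuous_on_eq_continuous_within by blast
  show ?thesis unfolding C1_within_def
  proof (intro exI conjI ballI)
    fix x assume x: "x \<in> S"
    have "(f has_vector_derivative f' (g x)) (at (g x) within g ` S)"
      using f(1) assms(3) x by (meson has_vector_derivative_within_subset image_subset_iff)
    from vector_diff_chain_within[OF g(1)[OF x] this]
    show "((\<lambda>x. f (g x)) has_vector_derivative (g' x *\<^sub>R f' (g x))) (at x within S)" by (simp add: o_def)
  next
    show "continuous_on S (\<lambda>x. g' x *\<^sub>R f' (g x))"
      by (intro continuous_intros g(2) continuous_on_compose2[OF f(2) cg assms(3)])
  qed
qed

lemma BijD: "f \<in> Bij S \<Longrightarrow> x \<in> S \<Longrightarrow> f x \<in> S" 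
  "f \<in> Bij S \<Longrightarrow> x \<in> S \<Longrightarrow> inv_into S f x \<in> S" 
  "f \<in> Bij S \<Longrightarrow> x \<in> S \<Longrightarrow> f (inv_into S f x) = x" 
  "f \<in> Bij S \<Longrightarrow> x \<in> S \<Longrightarrow> inv_into S f (f x) = x" 
  by (auto simp: Bij_def bij_betw_def f_inv_into_f inv_into_into)

lemma inv_into_restrict_inv:
  assumes "f \<in> Bij S" "x \<in> S" shows "inv_into S (restrict (inv_into S f) S) x = f x"
  by (rule inv_into_f_eq) (use assms restrict_inv_into_Bij[OF assms(1)] in \<open>auto simp: Bij_def bij_betw_def\<close>)

lemma inv_into_compose:
  assumes "f \<in> Bij S" "g \<in> Bij S" "x \<in> S" 
  shows "inv_into S (compose S f g) x = inv_into S g (inv_into S f x)"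
  by (rule inv_into_f_eq) (use assms compose_Bij[OF assms(1,2)] in \<open>auto simp: Bij_def bij_betw_def compose_def f_inv_into_f inv_into_into\<close>)

lemma group_Diff1_real:
  assumes nt: "\<And>x. x \<in> S \<Longrightarrow> at x within S \<noteq> bot"
  shows "group (Diff1_real S)"
  unfolding Diff1_real_def
proof (rule BijGroup_subgroupI)
  show "Diff1_real_carrier S \<subseteq> Bij S" by (auto simp: Diff1_real_carrier_def)
  have inv_id: "inv_into S (\<lambda>x\<in>S. x) x = x" if "x \<in> S" for x
    by (rule inv_into_f_eq) (use that in auto)
  have 1: "C1_within (\<lambda>x. x) S" unfolding C1_within_def 
    by (rule exI[of _ "\<lambda>_. 1"]) auto
  have 2: "((\<lambda>x\<in>S. x) has_real_derivative 1) (at x within S)" if "x \<in> S" for x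
    by (rule real_derivative_transform[OF that _ DERIV_ident]) simp
  show "(\<lambda>x\<in>S. x) \<in> Diff1_real_carrier S"
    using id_Bij[of S] 1 2 C1_within_cong[of S "\<lambda>x\<in>S. x" "\<lambda>x. x"] 
        C1_within_cong[of S "inv_into S (\<lambda>x\<in>S. x)" "\<lambda>x. x"]  zero_less_one
    by (auto simp: Diff1_real_carrier_def inv_id intro!: exI[of _ "1::real"])
next
  fix f g assume fg: "f \<in> Diff1_real_carrier S" "g \<in> Diff1_real_carrier S"
  then have B: "f \<in> Bij S" "g \<in> Bij S" by (auto simp: Diff1_real_carrier_def)
  have 1: "C1_within (compose S f g) S" 
  proof -
    have "C1_within (\<lambda>x. f (g x)) S"
      by (rule C1_within_compose) (use fg BijD(1)[OF B(2)] in \<open>auto simp: Diff1_real_carrier_def\<close>)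
    then show ?thesis
      by (subst C1_within_cong[of S _ "\<lambda>x. f (g x)"]) (simp_all add: compose_def)
  qed
  have 2: "C1_within (inv_into S (compose S f g)) S" 
  proof -
    have "C1_within (\<lambda>x. inv_into S g (inv_into S f x)) S"
      by (rule C1_within_compose) (use fg BijD(2)[OF B(1)] in \<open>auto simp: Diff1_real_carrier_def\<close>)
    then show ?thesis
      by (subst C1_within_cong[of S _ "\<lambda>x. inv_into S g (inv_into S f x)"]) (simp_all add: inv_into_compose[OF B])
  qed
  have 3: "\<exists>d>0. (compose S f g has_real_derivative d) (at x within S)" if x: "x \<in> S" for x
  proof -
    obtain d where d: "d > 0" "(g has_real_derivative d) (at x within S)"
      using fg x by (auto simp: Diff1_real_carrier_def)
    obtain e where e: "e > 0" "(f has_real_derivative e) (at (g x) within S)"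
      using fg(1) BijD(1)[OF B(2) x] unfolding Diff1_real_carrier_def by blast
    have "(f has_real_derivative e) (at (g x) within g ` S)"
      using DERIV_subset e(2) BijD(1)[OF B(2)] by blast
    from DERIV_image_chain[OF this d(2)] have "((\<lambda>x. f (g x)) has_real_derivative e * d) (at x within S)"
      by (simp add: o_def)
    then have "(compose S f g has_real_derivative e * d) (at x within S)"
      by (rule real_derivative_transform[OF x, rotated]) (simp add: compose_def)
    then show ?thesis using d e by (intro exI[of _ "e*d"]) auto
  qed
  show "compose S f g \<in> Diff1_real_carrier S"
    using 1 2 3 compose_Bij[OF B] by (auto simp: Diff1_real_carrier_def)
next
  fix f assume f: "f \<in> Diff1_real_carrier S"
  then have B: "f \<in> Bij S" by (auto simp: Diff1_real_carrier_def)
  let ?h = "restrict (inv_into S f) S"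
  have 1: "C1_within ?h S" 
    by (subst C1_within_cong[of S _ "inv_into S f"]) (use f in \<open>auto simp: Diff1_real_carrier_def\<close>)
  have 2: "C1_within (inv_into S ?h) S" 
    by (subst C1_within_cong[of S _ f]) (use f inv_into_restrict_inv[OF B] in \<open>auto simp: Diff1_real_carrier_def\<close>)
  have 3: "\<exists>d>0. (?h has_real_derivative d) (at x within S)" if x: "x \<in> S" for x
  proof -
    obtain d where d: "(?h has_real_derivative d) (at x within S)"
      using 1 x by (auto simp: C1_within_def has_real_derivative_iff_has_vector_derivative)
    obtain e where e: "e > 0" "(f has_real_derivative e) (at (?h x) within S)"
      using f x BijD(2)[OF B x] by (fastforce simp: Diff1_real_carrier_def)
    have "(f has_real_derivative e) (at (?h x) within ?h ` S)"
      by (rule DERIV_subset[OF e(2)]) (use BijD(2)[OF B] in auto)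
    from DERIV_image_chain[OF this d] have "((\<lambda>x. f (?h x)) has_real_derivative e * d) (at x within S)"
      by (simp add: o_def)
    then have "((\<lambda>x. x) has_real_derivative e * d) (at x within S)"
      by (rule real_derivative_transform[OF x, rotated]) (simp add: BijD[OF B])
    moreover have "((\<lambda>x. x) has_real_derivative 1) (at x within S)" by (rule DERIV_ident)
    ultimately have "e * d = 1" using nt[OF x] 
      by (metis vector_derivative_within has_real_derivative_iff_has_vector_derivative)
    then have "d > 0" using e by (metis zero_less_mult_pos zero_less_one)
    then show ?thesis using d by blast
  qed
  show "?h \<in> Diff1_real_carrier S"
    using 1 2 3 restrict_inv_into_Bij[OF B] by (auto simp: Diff1_real_carrier_def)
qed

lemma group_Diff1_line: "group Diff1_line" by (rule group_Diff1_real) simp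
lemma group_Diff1_interval: "group Diff1_interval" 
  by (rule group_Diff1_real) (simp add: trivial_limit_within islimpt_Icc)

lemma circle_curve_lift:
  assumes c: "\<And>t. cmod (G t) = 1" and d: "(G has_vector_derivative (r *\<^sub>R (\<i> * G t0))) (at t0)"
    and th: "G t0 = cis \<theta>"
  obtains q where "(q has_real_derivative r) (at t0)" "q t0 = \<theta>" "\<forall>\<^sub>F t in nhds t0. G t = cis (q t)"
proof -
  have nz: "G t \<noteq> 0" for t using c[of t] by auto
  have k: "((\<lambda>t. G t / G t0) has_vector_derivative (r *\<^sub>R \<i>)) (at t0)"
    using has_vector_derivative_divide[OF d, of "G t0"] nz by (simp add: scaleR_conv_of_real)
  have g1: "G t0 / G t0 \<notin> \<real>\<^sub>\<le>\<^sub>0" using nz by simp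
  have "((Ln \<circ> (\<lambda>t. G t / G t0)) has_vector_derivative (r *\<^sub>R \<i> * inverse (G t0 / G t0))) (at t0)"
    by (rule field_vector_diff_chain_at[OF k]) (rule has_field_derivative_Ln[OF g1])
  then have L: "((\<lambda>t. Ln (G t / G t0)) has_vector_derivative (r *\<^sub>R \<i>)) (at t0)" using nz by (simp add: o_def)
  have L2: "((\<lambda>t. Im (Ln (G t / G t0))) has_vector_derivative r) (at t0)"
    using bounded_linear.has_vector_derivative[OF bounded_linear_Im L] by simp
  show ?thesis
  proof (rule that)
    show "((\<lambda>t. \<theta> + Im (Ln (G t / G t0))) has_real_derivative r) (at t0)"
      using L2 by (auto simp: has_real_derivative_iff_has_vector_derivative intro!: derivative_eq_intros)
    show "\<theta> + Im (Ln (G t0 / G t0)) = \<theta>" using nz by simp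
    have "G t = cis (\<theta> + Im (Ln (G t / G t0)))" for t
    proof -
      have "Ln (G t / G t0) = \<i> * Im (Ln (G t / G t0))"
        using nz c by (intro complex_eqI) (simp_all add: norm_divide)
      then have "cis (Im (Ln (G t / G t0))) = exp (Ln (G t / G t0))" by (metis cis_conv_exp)
      also have "\<dots> = G t / G t0" using nz by simp
      finally show ?thesis using nz by (simp add: cis_mult[symmetric] th[symmetric])
    qed
    then show "\<forall>\<^sub>F t in nhds t0. G t = cis (\<theta> + Im (Ln (G t / G t0)))" by simp
  qed
qed

lemma circle_curve_derivative:
  assumes c: "\<And>t. cmod (G t) = 1" and d: "(G has_vector_derivative v) (at t0)"
  obtains r where "v = r *\<^sub>R (\<i> * G t0)"
proof
  have "((\<lambda>t. G t * cnj (G t)) has_vector_derivative (G t0 * cnj v + v * cnj (G t0))) (at t0)"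
    by (intro has_vector_derivative_mult d bounded_linear.has_vector_derivative[OF bounded_linear_cnj d])
  moreover have "(\<lambda>t. G t * cnj (G t)) = (\<lambda>t. 1)" using c by (simp add: complex_norm_square[symmetric] fun_eq_iff)
  ultimately have "G t0 * cnj v + v * cnj (G t0) = 0"
    by (metis has_vector_derivative_const vector_derivative_unique_at)
  moreover have "Re (G t0 * cnj v + v * cnj (G t0)) = 2 * Re (v * cnj (G t0))" by (simp add: algebra_simps)
  ultimately have "Re (v * cnj (G t0)) = 0" by simp
  then have e: "v * cnj (G t0) = \<i> * Im (v * cnj (G t0))" by (simp add: complex_eq_iff)
  have "v = v * cnj (G t0) * G t0" 
    using c[of t0] complex_norm_square[of "G t0"] by (simp add: mult.assoc mult.commute[of "cnj _"])
  then show "v = Im (v * cnj (G t0)) *\<^sub>R (\<i> * G t0)"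
    using e by (metis mult.assoc mult.left_commute scaleR_conv_of_real)
qed

lemma circle_chain:
  assumes c: "\<And>t. cmod (g (cis t)) = 1" 
    and d: "((\<lambda>t. g (cis t)) has_vector_derivative (r *\<^sub>R (\<i> * g (cis t0)))) (at t0)"
    and th: "g (cis t0) = cis \<theta>"
    and e: "((\<lambda>t. f (cis t)) has_vector_derivative v) (at \<theta>)"
  shows "((\<lambda>t. f (g (cis t))) has_vector_derivative r *\<^sub>R v) (at t0)"
proof -
  obtain q where q: "(q has_real_derivative r) (at t0)" "q t0 = \<theta>" "\<forall>\<^sub>F t in nhds t0. g (cis t) = cis (q t)"
    using circle_curve_lift[of "\<lambda>t. g (cis t)", OF c d th] by blast
  have "((\<lambda>t. f (cis t)) \<circ> q has_vector_derivative r *\<^sub>R v) (at t0)"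
    using q e by (intro vector_diff_chain_at) (auto simp: has_real_derivative_iff_has_vector_derivative)
  moreover have "\<forall>\<^sub>F t in nhds t0. ((\<lambda>t. f (cis t)) \<circ> q) t = f (g (cis t))"
    using q(3) by eventually_elim simp
  ultimately show ?thesis
    using has_vector_derivative_cong_ev[where x=t0 and S=UNIV and f="(\<lambda>t. f (cis t)) \<circ> q" and g="\<lambda>t. f (g (cis t))"]
      eventually_nhds_x_imp_x
    by (metis (mono_tags, lifting) eventually_mono)
qed

lemma ex_cis: "z \<in> circle \<Longrightarrow> \<exists>\<theta>. z = cis \<theta>"
  by (metis cis_Arg_unique cis_Arg sgn_eq complex_sgn_def dist_0_norm divide_self_if div_by_1 mem_sphere norm_zero sgn_div_norm scaleR_one inverse_1 zero_neq_one)

lemma C1_circle_compose: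
  assumes f: "C1_circle f" and g: "C1_circle g" and c: "\<And>z. z \<in> circle \<Longrightarrow> g z \<in> circle"
  shows "C1_circle (\<lambda>z. f (g z))"
proof -
  have c': "cmod (g (cis t)) = 1" for t using c[of "cis t"] by simp
  obtain f' g' where f: "\<And>t. ((\<lambda>t. f (cis t)) has_vector_derivative f' t) (at t)" "continuous_on UNIV f'"
    and g: "\<And>t. ((\<lambda>t. g (cis t)) has_vector_derivative g' t) (at t)" "continuous_on UNIV g'"
    using assms(1,2) unfolding C1_circle_def C1_within_def by (metis UNIV_I)
  have "\<exists>r. g' t = r *\<^sub>R (\<i> * g (cis t))" for t
    by (rule circle_curve_derivative[of "\<lambda>t. g (cis t)", OF c' g(1)]) blast
  then obtain r where r: "\<And>t. g' t = r t *\<^sub>R (\<i> * g (cis t))" by metis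
  have "\<exists>\<theta>. g (cis t) = cis \<theta>" for t by (rule ex_cis) (simp add: c')
  then obtain \<theta> where th: "\<And>t. g (cis t) = cis (\<theta> t)" by metis
  have D: "((\<lambda>t. f (g (cis t))) has_vector_derivative r t *\<^sub>R f' a) (at t)" if "g (cis t) = cis a" for t a
    by (rule circle_chain[where f=f and g=g, OF _ _ that f(1)]) (use c' g(1)[of t] r in simp_all)
  have r_eq: "r t = Re (g' t / (\<i> * g (cis t)))" for t 
    using c'[of t] by (auto simp: r scaleR_conv_of_real)
  have cr: "continuous_on UNIV r"
  proof -
    have "continuous_on UNIV (\<lambda>t. g (cis t))"
      using g(1) has_vector_derivative_continuous continuous_on_eq_continuous_within by blast
    then have "continuous_on UNIV (\<lambda>t. Re (g' t / (\<i> * g (cis t))))"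
      using c' by (intro continuous_intros g(2)) (auto, metis norm_zero zero_neq_one)
    then show ?thesis by (simp add: r_eq)
  qed
  have "isCont (\<lambda>t. r t *\<^sub>R f' (\<theta> t)) t0" for t0
  proof -
    obtain q where q: "(q has_real_derivative r t0) (at t0)" "\<forall>\<^sub>F t in nhds t0. g (cis t) = cis (q t)"
      using circle_curve_lift[of "\<lambda>t. g (cis t)" "r t0", OF c' _ th] g(1)[of t0] r by metis
    have "isCont (\<lambda>t. r t *\<^sub>R f' (q t)) t0"
      by (intro continuous_intros isCont_o2[OF DERIV_isCont[OF q(1)]]) 
        (use cr f(2) in \<open>auto simp: continuous_on_eq_continuous_at\<close>)
    moreover have "\<forall>\<^sub>F t in nhds t0. r t *\<^sub>R f' (q t) = r t *\<^sub>R f' (\<theta> t)"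
      using q(2) by eventually_elim (rule vector_derivative_unique_at[OF D D], auto simp: th)
    ultimately show ?thesis using isCont_cong by fastforce
  qed
  then show ?thesis unfolding C1_circle_def C1_within_def
    using D[OF th] by (intro exI[of _ "\<lambda>t. r t *\<^sub>R f' (\<theta> t)"]) (auto simp: continuous_on_eq_continuous_at)
qed

lemma C1_circle_cong:
  assumes "\<And>z. z \<in> circle \<Longrightarrow> f z = g z"
  shows "C1_circle f \<longleftrightarrow> C1_circle g"
  unfolding C1_circle_def by (rule C1_within_cong) (simp add: assms)

lemma cis_derivative: "(cis has_vector_derivative 1 *\<^sub>R (\<i> * cis t)) (at t)"
proof -
  have "((\<lambda>t. exp (t *\<^sub>R \<i>)) has_vector_derivative exp (t *\<^sub>R \<i>) * \<i>) (at t)"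
    by (rule exp_scaleR_has_vector_derivative_right)
  then show ?thesis by (simp add: cis_conv_exp[abs_def] scaleR_conv_of_real mult.commute)
qed

lemma group_Diff1_circle: "group Diff1_circle"
  unfolding Diff1_circle_def
proof (rule BijGroup_subgroupI)
  show "Diff1_circle_carrier \<subseteq> Bij circle" by (auto simp: Diff1_circle_carrier_def)
  have inv_id: "inv_into circle (\<lambda>x\<in>circle. x) x = x" if "x \<in> circle" for x
    by (rule inv_into_f_eq) (use that in auto)
  have 1: "C1_circle (\<lambda>x. x)" unfolding C1_circle_def C1_within_def 
    using cis_derivative by (intro exI[of _ "\<lambda>t. 1 *\<^sub>R (\<i> * cis t)"]) (auto intro!: continuous_intros)
  show "(\<lambda>x\<in>circle. x) \<in> Diff1_circle_carrier"
    using id_Bij[of circle] 1 cis_derivative C1_circle_cong[of "\<lambda>x\<in>circle. x" "\<lambda>x. x"] 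
        C1_circle_cong[of "inv_into circle (\<lambda>x\<in>circle. x)" "\<lambda>x. x"]  
    by (auto simp: Diff1_circle_carrier_def inv_id intro!: exI[of _ "1::real"])
next
  fix f g assume fg: "f \<in> Diff1_circle_carrier" "g \<in> Diff1_circle_carrier"
  then have B: "f \<in> Bij circle" "g \<in> Bij circle" by (auto simp: Diff1_circle_carrier_def)
  have 1: "C1_circle (compose circle f g)" 
  proof -
    have "C1_circle (\<lambda>x. f (g x))"
      by (rule C1_circle_compose) (use fg BijD(1)[OF B(2)] in \<open>auto simp: Diff1_circle_carrier_def\<close>)
    then show ?thesis
      by (subst C1_circle_cong[of _ "\<lambda>x. f (g x)"]) (simp_all add: compose_def)
  qed
  have 2: "C1_circle (inv_into circle (compose circle f g))" 
  proof -
    have "C1_circle (\<lambda>x. inv_into circle g (inv_into circle f x))"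
      by (rule C1_circle_compose) (use fg BijD(2)[OF B(1)] in \<open>auto simp: Diff1_circle_carrier_def\<close>)
    then show ?thesis
      by (subst C1_circle_cong[of _ "\<lambda>x. inv_into circle g (inv_into circle f x)"]) (simp_all add: inv_into_compose[OF B])
  qed
  have 3: "\<exists>d>0. ((\<lambda>s. compose circle f g (cis s)) has_vector_derivative (d *\<^sub>R (\<i> * compose circle f g (cis t)))) (at t)" for t
  proof -
    have c: "cmod (g (cis t)) = 1" for t using BijD(1)[OF B(2), of "cis t"] by simp
    obtain d where d: "d > 0" "((\<lambda>s. g (cis s)) has_vector_derivative (d *\<^sub>R (\<i> * g (cis t)))) (at t)"
      using fg by (auto simp: Diff1_circle_carrier_def)
    obtain \<theta> where th: "g (cis t) = cis \<theta>" using ex_cis[of "g (cis t)"] c by auto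
    obtain e where e: "e > 0" "((\<lambda>s. f (cis s)) has_vector_derivative (e *\<^sub>R (\<i> * f (cis \<theta>)))) (at \<theta>)"
      using fg by (auto simp: Diff1_circle_carrier_def)
    from circle_chain[where f=f and g=g, OF c d(2) th e(2)] d e show ?thesis
      by (intro exI[of _ "d*e"]) (simp add: compose_def th)
  qed
  show "compose circle f g \<in> Diff1_circle_carrier"
    using 1 2 3 compose_Bij[OF B] by (auto simp: Diff1_circle_carrier_def)
next
  fix f assume f: "f \<in> Diff1_circle_carrier"
  then have B: "f \<in> Bij circle" by (auto simp: Diff1_circle_carrier_def)
  let ?h = "restrict (inv_into circle f) circle"
  have 1: "C1_circle ?h" 
    by (subst C1_circle_cong[of _ "inv_into circle f"]) (use f in \<open>auto simp: Diff1_circle_carrier_def\<close>)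
  have 2: "C1_circle (inv_into circle ?h)" 
    by (subst C1_circle_cong[of _ f]) (use f inv_into_restrict_inv[OF B] in \<open>auto simp: Diff1_circle_carrier_def\<close>)
  have 3: "\<exists>d>0. ((\<lambda>s. ?h (cis s)) has_vector_derivative (d *\<^sub>R (\<i> * ?h (cis t)))) (at t)" for t
  proof -
    have c: "cmod (?h (cis t)) = 1" for t using BijD(2)[OF B, of "cis t"] by simp
    obtain v where v: "((\<lambda>s. ?h (cis s)) has_vector_derivative v) (at t)"
      using 1 unfolding C1_circle_def C1_within_def by blast
    obtain d where d: "((\<lambda>s. ?h (cis s)) has_vector_derivative (d *\<^sub>R (\<i> * ?h (cis t)))) (at t)"
      using circle_curve_derivative[of "\<lambda>s. ?h (cis s)", OF c v] v by metis
    obtain \<theta> where th: "?h (cis t) = cis \<theta>" using ex_cis[of "?h (cis t)"] c[of t] by auto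
    obtain e where e: "e > 0" "((\<lambda>s. f (cis s)) has_vector_derivative (e *\<^sub>R (\<i> * f (cis \<theta>)))) (at \<theta>)"
      using f by (auto simp: Diff1_circle_carrier_def)
    have fh: "f (?h (cis s)) = cis s" for s using BijD(3)[OF B, of "cis s"] by simp
    have "(cis has_vector_derivative d *\<^sub>R (e *\<^sub>R (\<i> * cis t))) (at t)"
      using circle_chain[where f=f and g="?h", OF c d th e(2)] unfolding fh th[symmetric] .
    from vector_derivative_unique_at[OF this cis_derivative] 
    have "(d * e) *\<^sub>R (\<i> * cis t) = 1 *\<^sub>R (\<i> * cis t)" by simp
    then have "d * e = 1" unfolding scaleR_cancel_right by simp
    then have "d > 0" using e by (metis zero_less_mult_pos2 zero_less_one)
    then show ?thesis using d by blast
  qed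
  show "?h \<in> Diff1_circle_carrier"
    using 1 2 3 restrict_inv_into_Bij[OF B] by (auto simp: Diff1_circle_carrier_def)
qed

end

theory Submission
  imports Defs "HOL-Algebra.Zassenhaus"
begin

text \<open>
  A torsion-free nilpotent group \<open>G\<close> has torsion-free abelian upper central factors, so ordering these
  factors gives a left order on \<open>G\<close>. If \<open>G\<close> is finitely generated, then it has polynomial growth.
  Hence the weights \<open>l x = c / (1 + |x|)\<^sup>p\<close>, where \<open>|x|\<close> is the word length and \<open>p\<close> is large, have
  sum 1, while \<open>l (g x) / l x\<close> tends to 1 as \<open>x\<close> leaves finite sets, because \<open>|g x|\<close> and \<open>|x|\<close>
  differ by a bounded amount. Place disjoint intervals \<open>I x\<close> of length \<open>l x\<close> in \<open>[0, 1]\<close> in the left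
  order, and let \<open>g\<close> map \<open>I x\<close> onto \<open>I (g x)\<close> by the Yoccoz map between intervals of these lengths.
  These maps compose functorially, have derivative 1 at the ends, and have derivative close to 1
  everywhere if the two lengths have ratio close to 1. So \<open>g\<close> becomes a \<open>C\<^sup>1\<close> diffeomorphism of the
  line that is the identity outside \<open>[0, 1]\<close>; it restricts to the interval and descends to the circle.
  This avoids an embedding of \<open>G\<close> into unitriangular matrices.
\<close>

section \<open>The Yoccoz family of interval maps\<close>

text \<open>Blowing up a left order with summable weights always gives homeomorphisms; the obstacle
  is continuity of the derivatives where infinitely many intervals accumulate. Weights decaying fast
  exponentially in the word length are summable on every finitely generated group, but their ratios
  under a translation need not tend to 1. Polynomial decay repairs the ratios and is summable only
  if balls grow polynomially, so nilpotency is used twice, for the order and for the weights. Affine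
  maps between the intervals would compose correctly, but their slopes at the ends differ from 1
  when the lengths differ. The Yoccoz maps are the projective maps of \<open>diag(r, 1)\<close> in
  an angular coordinate: they still multiply, and they can be normalized to end slope 1.
  Differentiability at accumulation points is never examined pointwise: the deviations of the slopes
  from 1 are bumps whose sum converges uniformly, and the blow-up is recovered by integrating this
  sum. The central layers are ordered by Zorn's lemma, which asks nothing about their
  generators.\<close>

definition yoccoz_norm :: "real \<Rightarrow> real \<Rightarrow> real" where
  "yoccoz_norm r \<theta> = (sin \<theta>)\<^sup>2 + r\<^sup>2 * (cos \<theta>)\<^sup>2"

text \<open>
  The angle \<open>yoccoz_angle r \<theta>\<close> in \<open>[0, \<pi>]\<close> has cotangent \<open>r cot \<theta>\<close>, which makes the cocycle property
  visible. The formula by \<open>arccos\<close> is also correct at the ends of the interval.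
\<close>
definition yoccoz_angle :: "real \<Rightarrow> real \<Rightarrow> real" where
  "yoccoz_angle r \<theta> = arccos (r * cos \<theta> / sqrt (yoccoz_norm r \<theta>))"

lemma yoccoz_norm_pos: assumes "r > 0" shows "yoccoz_norm r \<theta> > 0"
proof (cases "sin \<theta> = 0")
  case True
  then have "(cos \<theta>)\<^sup>2 = 1" using sin_cos_squared_add[of \<theta>] by simp
  then show ?thesis using assms True by (simp add: yoccoz_norm_def)
next
  case False
  then show ?thesis by (simp add: yoccoz_norm_def add_pos_nonneg)
qed

lemma yoccoz_norm_1 [simp]: "yoccoz_norm 1 \<theta> = 1"
  by (simp add: yoccoz_norm_def)

text \<open>Pythagoras: \<open>yoccoz_norm r \<theta>\<close> is the squared length of the vector
  \<open>(r * cos \<theta>, sin \<theta>)\<close>, and the two fractions are the coordinates of its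
  normalization.\<close>

lemma yoccoz_arg_square:
  assumes "r > 0"
  shows "1 - (r * cos \<theta> / sqrt (yoccoz_norm r \<theta>))\<^sup>2 = (sin \<theta> / sqrt (yoccoz_norm r \<theta>))\<^sup>2"
  using yoccoz_norm_pos[OF assms, of \<theta>]
  by (simp add: power_divide power_mult_distrib yoccoz_norm_def field_simps)

lemma yoccoz_arg_bounds:
  assumes "r > 0"
  shows "-1 \<le> r * cos \<theta> / sqrt (yoccoz_norm r \<theta>)" "r * cos \<theta> / sqrt (yoccoz_norm r \<theta>) \<le> 1"
proof -
  have "(r * cos \<theta> / sqrt (yoccoz_norm r \<theta>))\<^sup>2 \<le> 1"
    using yoccoz_arg_square[OF assms, of \<theta>] by (metis diff_ge_0_iff_ge zero_le_power2)
  then have "\<bar>r * cos \<theta> / sqrt (yoccoz_norm r \<theta>)\<bar> \<le> 1" by (simp only: abs_square_le_1)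
  then show "-1 \<le> r * cos \<theta> / sqrt (yoccoz_norm r \<theta>)" "r * cos \<theta> / sqrt (yoccoz_norm r \<theta>) \<le> 1"
    by linarith+
qed

lemma yoccoz_angle_bounds:
  assumes "r > 0" shows "0 \<le> yoccoz_angle r \<theta>" "yoccoz_angle r \<theta> \<le> pi"
  using yoccoz_arg_bounds[OF assms, of \<theta>] by (simp_all add: yoccoz_angle_def arccos_lbound arccos_ubound)

lemma cos_yoccoz_angle:
  assumes "r > 0" shows "cos (yoccoz_angle r \<theta>) = r * cos \<theta> / sqrt (yoccoz_norm r \<theta>)"
  using yoccoz_arg_bounds[OF assms, of \<theta>] by (simp add: yoccoz_angle_def)

lemma yoccoz_angle_ends:
  assumes "r > 0" shows "yoccoz_angle r 0 = 0" "yoccoz_angle r pi = pi"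
  using assms by (simp_all add: yoccoz_angle_def yoccoz_norm_def)

lemma yoccoz_angle_1: "0 \<le> \<theta> \<Longrightarrow> \<theta> \<le> pi \<Longrightarrow> yoccoz_angle 1 \<theta> = \<theta>"
  by (simp add: yoccoz_angle_def arccos_cos)

text \<open>The angle records the direction of \<open>(r * cos \<theta>, sin \<theta>)\<close>, and
  stretching by \<open>r\<close> and then by \<open>s\<close> is stretching by \<open>s * r\<close>.
  Only the square of the intermediate sine enters, so \<open>\<theta>\<close> can be
  arbitrary.\<close>

lemma yoccoz_angle_cocycle:
  assumes r: "r > 0" and s: "s > 0"
  shows "yoccoz_angle s (yoccoz_angle r \<theta>) = yoccoz_angle (s * r) \<theta>"
proof -
  let ?N = "yoccoz_norm r \<theta>"
  have N: "?N > 0" using r by (rule yoccoz_norm_pos)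
  have c: "cos (yoccoz_angle r \<theta>) = r * cos \<theta> / sqrt ?N" by (rule cos_yoccoz_angle[OF r])
  have "yoccoz_norm s (yoccoz_angle r \<theta>) = yoccoz_norm (s * r) \<theta> / ?N"
  proof -
    have "(sin (yoccoz_angle r \<theta>))\<^sup>2 = (sin \<theta> / sqrt ?N)\<^sup>2"
      unfolding sin_squared_eq c by (rule yoccoz_arg_square[OF r])
    then show ?thesis using N
      unfolding yoccoz_norm_def[of s] yoccoz_norm_def[of "s * r"] c
      by (simp add: power_divide power_mult_distrib add_divide_distrib mult_ac)
  qed
  then show ?thesis using N
    unfolding yoccoz_angle_def[of s] yoccoz_angle_def[of "s * r"] c by (simp add: real_sqrt_divide mult.assoc)
qed

lemma continuous_on_yoccoz_angle [continuous_intros]: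
  fixes f :: "real \<Rightarrow> real"
  assumes "r > 0" "continuous_on S f"
  shows "continuous_on S (\<lambda>x. yoccoz_angle r (f x))"
proof -
  have "yoccoz_norm r \<theta> \<noteq> 0" for \<theta> using yoccoz_norm_pos[OF assms(1), of \<theta>] by simp
  then show ?thesis
    unfolding yoccoz_angle_def using yoccoz_arg_bounds[OF assms(1)]
    by (intro continuous_on_arccos continuous_on_divide continuous_on_real_sqrt)
      (auto simp: yoccoz_norm_def intro!: continuous_intros assms(2))
qed

text \<open>The ends are left out because \<open>arccos\<close> is not differentiable at -1 and 1;
  \<open>excess_integral\<close> later passes over them by continuity.\<close>

lemma yoccoz_angle_derivative:
  assumes r: "r > 0" and \<theta>: "0 < \<theta>" "\<theta> < pi"
  shows "(yoccoz_angle r has_real_derivative r / yoccoz_norm r \<theta>) (at \<theta>)"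
proof -
  let ?N = "yoccoz_norm r" and ?y = "\<lambda>\<theta>. r * cos \<theta> / sqrt (yoccoz_norm r \<theta>)"
  have N: "?N \<theta> > 0" using r by (rule yoccoz_norm_pos)
  have s: "sin \<theta> > 0" using \<theta> by (rule sin_gt_zero)
  have dN: "(?N has_real_derivative 2 * sin \<theta> * cos \<theta> * (1 - r\<^sup>2)) (at \<theta>)"
    unfolding yoccoz_norm_def[abs_def] by (auto intro!: derivative_eq_intros simp: algebra_simps)
  have sq: "sqrt (?N \<theta>) * sqrt (?N \<theta>) = ?N \<theta>" "sqrt (?N \<theta>) > 0" using N by auto
  have dS: "((\<lambda>\<theta>. sqrt (?N \<theta>)) has_real_derivative sin \<theta> * cos \<theta> * (1 - r\<^sup>2) / sqrt (?N \<theta>)) (at \<theta>)"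
  proof -
    have "((\<lambda>\<theta>. sqrt (?N \<theta>)) has_real_derivative
        inverse (sqrt (?N \<theta>)) / 2 * (2 * sin \<theta> * cos \<theta> * (1 - r\<^sup>2))) (at \<theta>)"
      by (rule DERIV_chain2[OF DERIV_real_sqrt[OF N] dN])
    also have "inverse (sqrt (?N \<theta>)) / 2 * (2 * sin \<theta> * cos \<theta> * (1 - r\<^sup>2))
        = sin \<theta> * cos \<theta> * (1 - r\<^sup>2) / sqrt (?N \<theta>)"
      using sq(2) by (simp add: field_simps)
    finally show ?thesis .
  qed
  have alg: "((- (r * s)) * q - r * c * (s * c * k / q)) / (q * q) = - (r * s * (q * q + c\<^sup>2 * k) / (q * q * q))"
    if "q \<noteq> 0" for s c k q :: real
    using that by (simp add: field_simps power2_eq_square)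
  \<comment> \<open>This identity reduces the last factor of the numerator produced by the quotient
    rule to 1.\<close>
  have trig: "?N \<theta> + (cos \<theta>)\<^sup>2 * (1 - r\<^sup>2) = 1"
    by (simp add: yoccoz_norm_def algebra_simps)
  have dy: "(?y has_real_derivative - (r * sin \<theta> / (?N \<theta> * sqrt (?N \<theta>)))) (at \<theta>)"
  proof -
    have "(?y has_real_derivative ((- (r * sin \<theta>)) * sqrt (?N \<theta>)
        - r * cos \<theta> * (sin \<theta> * cos \<theta> * (1 - r\<^sup>2) / sqrt (?N \<theta>))) / (sqrt (?N \<theta>) * sqrt (?N \<theta>))) (at \<theta>)"
      using sq(2) by (intro DERIV_divide dS) (auto intro!: derivative_eq_intros)
    also have "((- (r * sin \<theta>)) * sqrt (?N \<theta>)
        - r * cos \<theta> * (sin \<theta> * cos \<theta> * (1 - r\<^sup>2) / sqrt (?N \<theta>))) / (sqrt (?N \<theta>) * sqrt (?N \<theta>))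
        = - (r * sin \<theta> * (sqrt (?N \<theta>) * sqrt (?N \<theta>) + (cos \<theta>)\<^sup>2 * (1 - r\<^sup>2))
            / (sqrt (?N \<theta>) * sqrt (?N \<theta>) * sqrt (?N \<theta>)))"
      by (rule alg) (use sq(2) in simp)
    also have "\<dots> = - (r * sin \<theta> / (?N \<theta> * sqrt (?N \<theta>)))"
      unfolding sq(1) trig by simp
    finally show ?thesis .
  qed
  have root: "sqrt (1 - (?y \<theta>)\<^sup>2) = sin \<theta> / sqrt (?N \<theta>)"
    unfolding yoccoz_arg_square[OF r] using s sq by simp
  have "0 < (sin \<theta> / sqrt (?N \<theta>))\<^sup>2" using s sq(2) by (intro zero_less_power divide_pos_pos)
  then have "(?y \<theta>)\<^sup>2 < 1" using yoccoz_arg_square[OF r, of \<theta>] by linarith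
  then have "\<bar>?y \<theta>\<bar> < 1" by (simp only: abs_square_less_1)
  then have "-1 < ?y \<theta>" "?y \<theta> < 1" by linarith+
  from DERIV_chain2[OF DERIV_arccos[OF this] dy]
  have "(yoccoz_angle r has_real_derivative
     inverse (- sqrt (1 - (?y \<theta>)\<^sup>2)) * - (r * sin \<theta> / (?N \<theta> * sqrt (?N \<theta>)))) (at \<theta>)"
    by (simp add: yoccoz_angle_def[abs_def])
  also have "inverse (- sqrt (1 - (?y \<theta>)\<^sup>2)) * - (r * sin \<theta> / (?N \<theta> * sqrt (?N \<theta>))) = r / ?N \<theta>"
    unfolding root using s sq(2) N by (simp add: divide_simps)
  finally show ?thesis .
qed

text \<open>The slope lies between 1, its value at the ends, and \<open>r\<^sup>2\<close>, its value
  in the middle: its deviation from 1 is \<open>r\<^sup>2 - 1\<close> times a factor in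
  [0, 1].\<close>

lemma yoccoz_slope_bound:
  assumes "r > 0" shows "\<bar>r\<^sup>2 / yoccoz_norm r \<theta> - 1\<bar> \<le> \<bar>r\<^sup>2 - 1\<bar>"
proof -
  have N: "yoccoz_norm r \<theta> > 0" using assms by (rule yoccoz_norm_pos)
  have "r\<^sup>2 - yoccoz_norm r \<theta> = (r\<^sup>2 - 1) * (sin \<theta>)\<^sup>2"
    unfolding yoccoz_norm_def cos_squared_eq by (simp add: algebra_simps)
  then have "r\<^sup>2 / yoccoz_norm r \<theta> - 1 = (r\<^sup>2 - 1) * ((sin \<theta>)\<^sup>2 / yoccoz_norm r \<theta>)"
    using N by (simp add: field_simps)
  moreover have "0 \<le> (sin \<theta>)\<^sup>2 / yoccoz_norm r \<theta>" "(sin \<theta>)\<^sup>2 / yoccoz_norm r \<theta> \<le> 1"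
    using N by (simp_all add: yoccoz_norm_def)
  ultimately show ?thesis by (simp only: abs_mult abs_of_nonneg mult_left_le abs_ge_zero)
qed

section \<open>Packing disjoint intervals\<close>

definition clip :: "real \<Rightarrow> real \<Rightarrow> real \<Rightarrow> real" where
  "clip p l t = max 0 (min l (t - p))"

lemma clip_bounds: "0 < l \<Longrightarrow> 0 \<le> clip p l t" "0 < l \<Longrightarrow> clip p l t \<le> l"
  by (auto simp: clip_def)

text \<open>\<open>clip p l t\<close> is the length of the part of \<open>[p, p + l]\<close> to the
  left of \<open>t\<close>. Induction on the number of intervals: all others end before the left
  endpoint of the rightmost one, which becomes the new \<open>b\<close>. This stands in for
  additivity of length.\<close>

lemma sum_clip_le:
  fixes p l :: "'i \<Rightarrow> real"
  assumes "finite F" and "\<And>x. x \<in> F \<Longrightarrow> 0 \<le> p x \<and> 0 < l x"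
    and "\<And>x y. x \<in> F \<Longrightarrow> y \<in> F \<Longrightarrow> x \<noteq> y \<Longrightarrow> p x + l x \<le> p y \<or> p y + l y \<le> p x"
    and "0 \<le> b" "\<And>x. x \<in> F \<Longrightarrow> p x + l x \<le> b" and t: "0 \<le> t"
  shows "(\<Sum>x\<in>F. clip (p x) (l x) t) \<le> min t b"
  using assms(1-5)
proof (induction "card F" arbitrary: F b)
  case 0
  then show ?case using t by simp
next
  case (Suc n)
  then have "F \<noteq> {}" by auto
  then obtain m where m: "m \<in> F" "\<And>x. x \<in> F \<Longrightarrow> p x \<le> p m"
    using ex_is_arg_min_if_finite[of F "\<lambda>x. - p x"] Suc.prems(1) by (auto simp: is_arg_min_linorder)
  have pm: "0 \<le> p m" "0 < l m" "p m + l m \<le> b" using Suc.prems m by auto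
  have "(\<Sum>x\<in>F - {m}. clip (p x) (l x) t) \<le> min t (p m)"
  proof (rule Suc.hyps(1))
    show "p x + l x \<le> p m" if "x \<in> F - {m}" for x
    proof -
      have "p x \<le> p m" "0 < l x" using m(2) Suc.prems(2) that by blast+
      then show ?thesis using Suc.prems(3)[of x m] m(1) that pm(2) by fastforce
    qed
    show "n = card (F - {m})" using Suc.hyps(2) Suc.prems(1) m(1) by simp
    show "finite (F - {m})" using Suc.prems(1) by simp
    show "0 \<le> p x \<and> 0 < l x" if "x \<in> F - {m}" for x using Suc.prems(2) that by blast
    show "p x + l x \<le> p y \<or> p y + l y \<le> p x" if "x \<in> F - {m}" "y \<in> F - {m}" "x \<noteq> y" for x y
      using Suc.prems(3) that by blast
  qed (rule pm(1))
  moreover have "(\<Sum>x\<in>F. clip (p x) (l x) t) = clip (p m) (l m) t + (\<Sum>x\<in>F - {m}. clip (p x) (l x) t)"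
    using Suc.prems(1) m(1) by (rule sum.remove)
  moreover have "clip (p m) (l m) t + min t (p m) \<le> min t b"
    using pm t by (auto simp: clip_def)
  ultimately show ?case by linarith
qed

section \<open>Blowing up an ordered set\<close>

text \<open>Conjugation of \<open>yoccoz_angle\<close> by scalings. At the ends the slope formula
  for \<open>yoccoz_angle r\<close> gives \<open>1 / r\<close> and the scalings contribute
  \<open>b / a\<close>, so \<open>r = b / a\<close> is the parameter with end slope 1.\<close>

definition yoccoz :: "real \<Rightarrow> real \<Rightarrow> real \<Rightarrow> real" where
  "yoccoz a b s = b / pi * yoccoz_angle (b / a) (pi * s / a)"

definition yoccoz_slope :: "real \<Rightarrow> real \<Rightarrow> real \<Rightarrow> real" where
  "yoccoz_slope a b s = (b / a)\<^sup>2 / yoccoz_norm (b / a) (pi * s / a)"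

context
  fixes a b :: real
  assumes a: "0 < a" and b: "0 < b"
begin

lemma yoccoz_0 [simp]: "yoccoz a b 0 = 0"
  using a b by (simp add: yoccoz_def yoccoz_angle_ends)

lemma yoccoz_end [simp]: "yoccoz a b a = b"
  using a b by (simp add: yoccoz_def yoccoz_angle_ends)

lemma yoccoz_bounds: "0 \<le> yoccoz a b s" "yoccoz a b s \<le> b"
proof -
  have r: "0 < b / a" using a b by simp
  show "0 \<le> yoccoz a b s" using b yoccoz_angle_bounds[OF r] by (simp add: yoccoz_def)
  have "b / pi * yoccoz_angle (b / a) (pi * s / a) \<le> b / pi * pi"
    using b yoccoz_angle_bounds(2)[OF r] by (intro mult_left_mono) auto
  then show "yoccoz a b s \<le> b" by (simp add: yoccoz_def)
qed

lemma yoccoz_cocycle: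
  assumes "0 < c" shows "yoccoz b c (yoccoz a b s) = yoccoz a c s"
proof -
  have "pi * yoccoz a b s / b = yoccoz_angle (b / a) (pi * s / a)" using b by (simp add: yoccoz_def)
  moreover have "yoccoz_angle (c / b) (yoccoz_angle (b / a) (pi * s / a)) = yoccoz_angle (c / a) (pi * s / a)"
    using yoccoz_angle_cocycle[of "b / a" "c / b"] a b assms by simp
  ultimately show ?thesis unfolding yoccoz_def[of b c] yoccoz_def[of a c] by simp
qed

lemma continuous_on_yoccoz:
  "continuous_on S f \<Longrightarrow> continuous_on S (\<lambda>x::real. yoccoz a b (f x))"
  unfolding yoccoz_def using a b by (intro continuous_intros) auto

lemma yoccoz_derivative:
  assumes "0 < s" "s < a"
  shows "(yoccoz a b has_real_derivative yoccoz_slope a b s) (at s)"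
proof -
  have "(yoccoz_angle (b / a) has_real_derivative (b / a) / yoccoz_norm (b / a) (pi * s / a)) (at (pi * s / a))"
    using assms a b by (intro yoccoz_angle_derivative) (auto simp: field_simps)
  moreover have "((\<lambda>s. pi * s / a) has_real_derivative pi / a) (at s)"
    using a by (auto intro!: derivative_eq_intros)
  ultimately have "((\<lambda>s. yoccoz_angle (b / a) (pi * s / a)) has_real_derivative
      (b / a) / yoccoz_norm (b / a) (pi * s / a) * (pi / a)) (at s)"
    by (rule DERIV_chain2)
  from DERIV_cmult[OF this, of "b / pi"] show ?thesis
    by (simp add: yoccoz_def[abs_def] yoccoz_slope_def power2_eq_square mult_ac)
qed

lemma yoccoz_slope_pos: "0 < yoccoz_slope a b s"
  unfolding yoccoz_slope_def using a b by (intro divide_pos_pos yoccoz_norm_pos) auto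

lemma yoccoz_slope_ends [simp]: "yoccoz_slope a b 0 = 1" "yoccoz_slope a b a = 1"
  using a b by (simp_all add: yoccoz_slope_def yoccoz_norm_def)

lemma yoccoz_slope_dist: "\<bar>yoccoz_slope a b s - 1\<bar> \<le> \<bar>(b / a)\<^sup>2 - 1\<bar>"
  unfolding yoccoz_slope_def using a b by (intro yoccoz_slope_bound) simp

lemma continuous_on_yoccoz_slope:
  assumes "continuous_on S f" shows "continuous_on S (\<lambda>x::real. yoccoz_slope a b (f x))"
proof -
  have "yoccoz_norm (b / a) \<theta> \<noteq> 0" for \<theta> using yoccoz_norm_pos[of "b / a" \<theta>] a b by simp
  then show ?thesis unfolding yoccoz_slope_def using a
    by (intro continuous_on_divide continuous_on_const)
      (auto simp: yoccoz_norm_def intro!: continuous_intros assms)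
qed

end

lemma yoccoz_refl: "0 < a \<Longrightarrow> 0 \<le> s \<Longrightarrow> s \<le> a \<Longrightarrow> yoccoz a a s = s"
  by (simp add: yoccoz_def yoccoz_angle_1 divide_le_eq)

lemma has_sum_diff_real:
  fixes f g :: "'i \<Rightarrow> real"
  assumes "(f has_sum a) A" "(g has_sum b) A"
  shows "((\<lambda>x. f x - g x) has_sum (a - b)) A"
  using has_sum_add[OF assms(1), of "\<lambda>x. - g x" "- b"] assms(2) by (simp add: has_sum_uminus)

section \<open>Intervals placed along a weighted linear order\<close>

locale weighted_order =
  fixes X :: "'i set" and lt :: "'i \<Rightarrow> 'i \<Rightarrow> bool" and l :: "'i \<Rightarrow> real"
  assumes lt_irrefl: "x \<in> X \<Longrightarrow> \<not> lt x x"
    and lt_trans: "x \<in> X \<Longrightarrow> y \<in> X \<Longrightarrow> z \<in> X \<Longrightarrow> lt x y \<Longrightarrow> lt y z \<Longrightarrow> lt x z"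
    and lt_total: "x \<in> X \<Longrightarrow> y \<in> X \<Longrightarrow> x \<noteq> y \<Longrightarrow> lt x y \<or> lt y x"
    and l_pos: "x \<in> X \<Longrightarrow> 0 < l x"
    and l_sum: "(l has_sum 1) X"
begin

definition below :: "'i \<Rightarrow> 'i set" where "below x = {y \<in> X. lt y x}"

definition pos :: "'i \<Rightarrow> real" where "pos x = infsum l (below x)"

definition covered :: "'i \<Rightarrow> real \<Rightarrow> real" where "covered x t = clip (pos x) (l x) t"

lemma below_subset: "below x \<subseteq> X" by (auto simp: below_def)

lemma l_summable: "A \<subseteq> X \<Longrightarrow> l summable_on A"
  using l_sum summable_on_subset has_sum_imp_summable by blast

lemma infsum_l [simp]: "infsum l X = 1"
  using l_sum by (rule infsumI)

lemma pos_nonneg: "x \<in> X \<Longrightarrow> 0 \<le> pos x"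
  unfolding pos_def using below_subset l_pos by (intro infsum_nonneg) (auto intro: less_imp_le)

lemma pos_plus_l: "x \<in> X \<Longrightarrow> pos x + l x = infsum l (insert x (below x))"
  using lt_irrefl by (subst infsum_insert) (auto simp: pos_def below_def intro!: l_summable)

lemma pos_less: assumes "x \<in> X" "y \<in> X" "lt x y" shows "pos x + l x \<le> pos y"
  unfolding pos_plus_l[OF assms(1)] unfolding pos_def
proof (rule infsum_mono2)
  show sub: "insert x (below x) \<subseteq> below y"
    using assms lt_trans[OF _ assms(1,2) _ assms(3)] by (auto simp: below_def)
  show "l summable_on insert x (below x)" "l summable_on below y"
    using assms(1) below_subset by (auto intro!: l_summable)
  show "0 \<le> l z" if "z \<in> below y - insert x (below x)" for z
    using that below_subset[of y] l_pos[of z] by auto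
qed

lemma pos_le_1: assumes "x \<in> X" shows "pos x + l x \<le> 1"
  unfolding pos_plus_l[OF assms(1)] infsum_l[symmetric]
proof (rule infsum_mono2)
  show "insert x (below x) \<subseteq> X" using assms below_subset by auto
  then show "l summable_on insert x (below x)" by (rule l_summable)
  show "0 \<le> l z" if "z \<in> X - insert x (below x)" for z using that l_pos[of z] by auto
qed (rule l_summable, rule order_refl)

lemma intervals_disjoint:
  "x \<in> X \<Longrightarrow> y \<in> X \<Longrightarrow> x \<noteq> y \<Longrightarrow> pos x + l x \<le> pos y \<or> pos y + l y \<le> pos x"
  using lt_total pos_less by blast

lemma covered_bounds: assumes "x \<in> X" shows "0 \<le> covered x t" "covered x t \<le> l x"
  using clip_bounds[OF l_pos[OF assms]] by (auto simp: covered_def)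

lemma covered_summable: "A \<subseteq> X \<Longrightarrow> (\<lambda>x. covered x t) summable_on A"
  by (rule summable_on_comparison_test[OF l_summable]) (use covered_bounds in auto)

lemma covered_left: "t \<le> pos x \<Longrightarrow> x \<in> X \<Longrightarrow> covered x t = 0"
  by (auto simp: covered_def clip_def)

lemma covered_right: "pos x + l x \<le> t \<Longrightarrow> x \<in> X \<Longrightarrow> covered x t = l x"
  using l_pos[of x] by (auto simp: covered_def clip_def)

text \<open>The disjoint intervals have total length 1, so they fill \<open>[0, 1]\<close> up to measure zero.\<close>
lemma infsum_covered: assumes t: "0 \<le> t" "t \<le> 1" shows "infsum (\<lambda>x. covered x t) X = t"
proof (rule antisym)
  show "infsum (\<lambda>x. covered x t) X \<le> t"
  proof (rule infsum_le_finite_sums[OF covered_summable[OF order_refl]])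
    fix F assume F: "finite F" "F \<subseteq> X"
    have "(\<Sum>x\<in>F. clip (pos x) (l x) t) \<le> min t 1"
    proof (rule sum_clip_le[OF F(1)])
      show "pos x + l x \<le> pos y \<or> pos y + l y \<le> pos x" if "x \<in> F" "y \<in> F" "x \<noteq> y" for x y
        using intervals_disjoint[of x y] that F by auto
      show "0 \<le> pos x \<and> 0 < l x" if "x \<in> F" for x
        using pos_nonneg[of x] l_pos[of x] that F by auto
      show "pos x + l x \<le> 1" if "x \<in> F" for x using pos_le_1[of x] that F by auto
    qed (use t in auto)
    then show "(\<Sum>x\<in>F. covered x t) \<le> t" by (simp add: covered_def)
  qed
  have "infsum (\<lambda>x. l x - covered x t) X \<le> 1 - t"
  proof (rule infsum_le_finite_sums)
    show "(\<lambda>x. l x - covered x t) summable_on X"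
      by (rule summable_on_comparison_test[OF l_summable]) (use covered_bounds in auto)
    fix F assume F: "finite F" "F \<subseteq> X"
    \<comment> \<open>The packing bound again, for the mirror images under
      \<open>t \<mapsto> 1 - t\<close>: left of \<open>1 - t\<close> they show what the original
      intervals have right of \<open>t\<close>. As the total length is 1, this is the converse
      inequality.\<close>
    have "(\<Sum>x\<in>F. clip (1 - pos x - l x) (l x) (1 - t)) \<le> min (1 - t) 1"
    proof (rule sum_clip_le[OF F(1)])
      show "1 - pos x - l x + l x \<le> 1 - pos y - l y \<or> 1 - pos y - l y + l y \<le> 1 - pos x - l x"
        if "x \<in> F" "y \<in> F" "x \<noteq> y" for x y
        using intervals_disjoint[OF subsetD[OF F(2) that(1)] subsetD[OF F(2) that(2)] that(3)] by linarith
      show "0 \<le> 1 - pos x - l x \<and> 0 < l x" if "x \<in> F" for x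
        using pos_le_1[of x] l_pos[of x] that F by auto
      show "1 - pos x - l x + l x \<le> 1" if "x \<in> F" for x
        using pos_nonneg[of x] that F by auto
    qed (use t in auto)
    moreover have "clip (1 - pos x - l x) (l x) (1 - t) = l x - covered x t" if "x \<in> F" for x
      using l_pos[of x] that F by (auto simp: covered_def clip_def)
    ultimately show "(\<Sum>x\<in>F. l x - covered x t) \<le> 1 - t" by simp
  qed
  moreover have "infsum (\<lambda>x. l x - covered x t) X = 1 - infsum (\<lambda>x. covered x t) X"
    by (intro infsumI has_sum_diff_real l_sum has_sum_infsum covered_summable order_refl)
  ultimately show "t \<le> infsum (\<lambda>x. covered x t) X" by linarith
qed

text \<open>The last clause says that the ratio of lengths tends to 1 along complements of finite
  sets. It is stated for the square because that is what bounds the distance of the Yoccoz slopes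
  from 1.\<close>

definition slow_automorphism :: "('i \<Rightarrow> 'i) \<Rightarrow> bool" where
  "slow_automorphism g \<longleftrightarrow> bij_betw g X X \<and> (\<forall>x\<in>X. \<forall>y\<in>X. lt x y \<longrightarrow> lt (g x) (g y))
     \<and> (\<forall>\<epsilon>>0. finite {x \<in> X. \<epsilon> \<le> \<bar>(l (g x) / l x)\<^sup>2 - 1\<bar>})"

definition moved :: "('i \<Rightarrow> 'i) \<Rightarrow> 'i \<Rightarrow> real \<Rightarrow> real" where
  "moved g x t = yoccoz (l x) (l (g x)) (covered x t)"

text \<open>
  A point \<open>x\<close> is replaced by the interval \<open>[pos x, pos x + l x]\<close>. The part of it to the left of \<open>t\<close> has
  length \<open>covered x t\<close>, and its image under the blow-up of \<open>g\<close> has length \<open>moved g x t\<close>. On \<open>[0, 1]\<close>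
  the blow-up maps \<open>t\<close> to the sum of the lengths \<open>moved g x t\<close>; subtracting \<open>covered x t\<close> makes the
  definition correct on the whole line.
\<close>
definition blowup :: "('i \<Rightarrow> 'i) \<Rightarrow> real \<Rightarrow> real" where
  "blowup g t = t + infsum (\<lambda>x. moved g x t - covered x t) X"

lemma slow_automorphismD:
  assumes "slow_automorphism g"
  shows "bij_betw g X X" "x \<in> X \<Longrightarrow> g x \<in> X" "x \<in> X \<Longrightarrow> 0 < l (g x)"
  using assms l_pos unfolding slow_automorphism_def bij_betw_def by auto

section \<open>The blow-up of one automorphism\<close>

context
  fixes g assumes g: "slow_automorphism g"
begin

text \<open>A strictly increasing bijection of a total order also reflects the order, which gives
  surjectivity.\<close>

lemma bij_below: assumes "x \<in> X" shows "bij_betw g (below x) (below (g x))"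
proof -
  have b: "bij_betw g X X" and m: "\<And>x y. x \<in> X \<Longrightarrow> y \<in> X \<Longrightarrow> lt x y \<Longrightarrow> lt (g x) (g y)"
    using g by (auto simp: slow_automorphism_def)
  have gX: "g y \<in> X" if "y \<in> X" for y using b that by (auto simp: bij_betw_def)
  have "g ` below x = below (g x)"
  proof
    show "g ` below x \<subseteq> below (g x)" using assms m gX by (auto simp: below_def)
    show "below (g x) \<subseteq> g ` below x"
    proof
      fix z assume z: "z \<in> below (g x)"
      then obtain y where y: "y \<in> X" "z = g y" using b by (auto simp: below_def bij_betw_def)
      have "\<not> lt x y" if "lt x y"
        using z y m[OF assms y(1) that] lt_trans[of "g x" "g y" "g x"] lt_irrefl[of "g x"] gX assms
        by (auto simp: below_def)
      moreover have "x \<noteq> y" using z y lt_irrefl[of "g x"] gX assms by (auto simp: below_def)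
      ultimately have "lt y x" using lt_total assms y by blast
      then show "z \<in> g ` below x" using y by (auto simp: below_def)
    qed
  qed
  then show ?thesis using b below_subset unfolding bij_betw_def by (meson inj_on_subset)
qed

lemma lg_summable: "A \<subseteq> X \<Longrightarrow> (\<lambda>x. l (g x)) summable_on A"
  using summable_on_reindex_bij_betw[of g X X l] slow_automorphismD(1)[OF g] l_summable[OF order_refl]
    summable_on_subset by blast

lemma pos_image: "x \<in> X \<Longrightarrow> infsum (\<lambda>y. l (g y)) (below x) = pos (g x)"
  unfolding pos_def by (rule infsum_reindex_bij_betw[OF bij_below])

lemma moved_bounds: assumes "x \<in> X" shows "0 \<le> moved g x t" "moved g x t \<le> l (g x)"
  using yoccoz_bounds[OF l_pos[OF assms] slow_automorphismD(3)[OF g assms]] by (auto simp: moved_def)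

lemma moved_summable: "A \<subseteq> X \<Longrightarrow> (\<lambda>x. moved g x t) summable_on A"
  by (rule summable_on_comparison_test[OF lg_summable]) (use moved_bounds in auto)

lemma moved_left: assumes "t \<le> pos x" "x \<in> X" shows "moved g x t = 0"
  using covered_left[OF assms] l_pos assms slow_automorphismD(3)[OF g] by (simp add: moved_def)

lemma moved_right: assumes "pos x + l x \<le> t" "x \<in> X" shows "moved g x t = l (g x)"
  using covered_right[OF assms] l_pos assms slow_automorphismD(3)[OF g] by (simp add: moved_def)

lemma blowup_has_sum: "((\<lambda>x. moved g x t - covered x t) has_sum (blowup g t - t)) X"
proof -
  have "((\<lambda>x. moved g x t - covered x t) has_sum (infsum (\<lambda>x. moved g x t) X - infsum (\<lambda>x. covered x t) X)) X"
    by (intro has_sum_diff_real has_sum_infsum covered_summable moved_summable order_refl)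
  then show ?thesis unfolding blowup_def by (simp add: has_sum_infsum has_sum_imp_summable)
qed

lemma blowup_eq: assumes "0 \<le> t" "t \<le> 1" shows "blowup g t = infsum (\<lambda>x. moved g x t) X"
proof -
  have "infsum (\<lambda>x. moved g x t - covered x t) X = infsum (\<lambda>x. moved g x t) X - infsum (\<lambda>x. covered x t) X"
    by (intro infsumI has_sum_diff_real has_sum_infsum covered_summable moved_summable order_refl)
  then show ?thesis using infsum_covered[OF assms] by (simp add: blowup_def)
qed

lemma infsum_lg: "infsum (\<lambda>x. l (g x)) X = 1"
  using infsum_reindex_bij_betw[OF slow_automorphismD(1)[OF g], of l] by simp

text \<open>Left of 0 all terms vanish. Right of 1 they are \<open>l (g x) - l x\<close>, and both
  families of lengths sum to 1 because \<open>g\<close> permutes \<open>X\<close>.\<close>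

lemma blowup_outside: assumes "t \<le> 0 \<or> 1 \<le> t" shows "blowup g t = t"
proof (cases "t \<le> 0")
  case True
  have "moved g x t - covered x t = 0" if x: "x \<in> X" for x
  proof -
    have "t \<le> pos x" using pos_nonneg[OF x] True by linarith
    then show ?thesis using x by (simp add: covered_left moved_left)
  qed
  then have "infsum (\<lambda>x. moved g x t - covered x t) X = 0" by (intro infsum_0) auto
  then show ?thesis by (simp add: blowup_def)
next
  case False
  have "moved g x t - covered x t = l (g x) - l x" if x: "x \<in> X" for x
  proof -
    have "pos x + l x \<le> t" using pos_le_1[OF x] False assms by linarith
    then show ?thesis using x by (simp add: covered_right moved_right)
  qed
  then have "infsum (\<lambda>x. moved g x t - covered x t) X = infsum (\<lambda>x. l (g x) - l x) X"
    by (rule infsum_cong)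
  also have "\<dots> = infsum (\<lambda>x. l (g x)) X - infsum l X"
    by (intro infsumI has_sum_diff_real has_sum_infsum l_summable lg_summable order_refl)
  finally show ?thesis by (simp add: blowup_def infsum_lg)
qed

lemma blowup_range:
  assumes "0 \<le> t" "t \<le> 1" shows "0 \<le> blowup g t" "blowup g t \<le> 1"
proof -
  show "0 \<le> blowup g t" unfolding blowup_eq[OF assms] using moved_bounds by (intro infsum_nonneg) auto
  show "blowup g t \<le> 1" unfolding blowup_eq[OF assms] infsum_lg[symmetric]
    using moved_bounds by (intro infsum_mono moved_summable lg_summable) auto
qed

lemma pos_plus_l_image:
  assumes "x \<in> X" shows "pos (g x) + l (g x) = infsum (\<lambda>y. l (g y)) (insert x (below x))"
proof -
  have "x \<notin> below x" using assms lt_irrefl by (simp add: below_def)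
  then show ?thesis
    using assms below_subset by (subst infsum_insert) (auto simp: pos_image intro!: lg_summable)
qed

text \<open>No interval from \<open>x\<close> onwards is entered before \<open>t\<close>, and each
  earlier one contributes at most the full length of its image; these lengths add up to
  \<open>pos (g x)\<close>.\<close>

lemma blowup_le:
  assumes "0 \<le> t" "t \<le> 1" "x \<in> X" "t \<le> pos x"
  shows "blowup g t \<le> pos (g x)"
  unfolding blowup_eq[OF assms(1,2)] pos_image[OF assms(3), symmetric]
proof (rule infsum_mono_neutral)
  show "moved g y t \<le> 0" if "y \<in> X - below x" for y
  proof -
    have y: "y \<in> X" "x = y \<or> lt x y" using that lt_total assms(3) by (auto simp: below_def)
    then have "t \<le> pos y" using assms pos_less[of x y] l_pos[of x] by auto
    then show ?thesis using moved_left y by simp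
  qed
qed (use below_subset moved_bounds in \<open>auto intro!: moved_summable lg_summable\<close>)

lemma blowup_ge:
  assumes "0 \<le> t" "t \<le> 1" "x \<in> X" "pos x + l x \<le> t"
  shows "pos (g x) + l (g x) \<le> blowup g t"
  unfolding blowup_eq[OF assms(1,2)] pos_plus_l_image[OF assms(3)]
proof (rule infsum_mono_neutral)
  show "l (g y) \<le> moved g y t" if "y \<in> insert x (below x) \<inter> X" for y
  proof -
    have y: "y \<in> X" "y = x \<or> lt y x" using that by (auto simp: below_def)
    then have "pos y + l y \<le> t" using assms pos_less[of y x] l_pos[of x] by auto
    then show ?thesis using moved_right y by simp
  qed
qed (use assms below_subset moved_bounds in \<open>auto intro!: moved_summable lg_summable\<close>)

text \<open>At such a \<open>t\<close> every earlier interval is exhausted and no later one is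
  entered, so only \<open>x\<close> contributes partially.\<close>

lemma blowup_in:
  assumes "0 \<le> t" "t \<le> 1" and x: "x \<in> X" "pos x \<le> t" "t \<le> pos x + l x"
  shows "blowup g t = pos (g x) + moved g x t"
proof -
  have "blowup g t = infsum (\<lambda>y. moved g y t) (insert x (below x))"
    unfolding blowup_eq[OF assms(1,2)]
  proof (rule infsum_cong_neutral)
    show "moved g y t = 0" if "y \<in> X - insert x (below x)" for y
    proof -
      have y: "y \<in> X" "lt x y" using that lt_total x(1) by (auto simp: below_def)
      then have "t \<le> pos y" using x pos_less[of x y] by auto
      then show ?thesis using moved_left y by simp
    qed
  qed (use x below_subset in auto)
  also have "\<dots> = moved g x t + infsum (\<lambda>y. moved g y t) (below x)"
    using lt_irrefl x below_subset by (subst infsum_insert) (auto simp: below_def intro!: moved_summable)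
  also have "infsum (\<lambda>y. moved g y t) (below x) = infsum (\<lambda>y. l (g y)) (below x)"
  proof (rule infsum_cong)
    fix y assume "y \<in> below x"
    then have y: "y \<in> X" "lt y x" by (auto simp: below_def)
    then have "pos y + l y \<le> t" using x pos_less[of y x] by auto
    then show "moved g y t = l (g y)" using moved_right y by simp
  qed
  finally show ?thesis using pos_image[OF x(1)] by simp
qed

text \<open>This is what makes composition termwise: a second blow-up applied to
  \<open>blowup g t\<close> sees, in the interval of \<open>g x\<close>, only the quantity
  \<open>moved g x t\<close>.\<close>

lemma covered_blowup:
  assumes t: "0 \<le> t" "t \<le> 1" and x: "x \<in> X"
  shows "covered (g x) (blowup g t) = moved g x t"
proof -
  have gx: "g x \<in> X" "0 < l (g x)" using slow_automorphismD[OF g] x by auto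
  consider "t \<le> pos x" | "pos x + l x \<le> t" | "pos x \<le> t" "t \<le> pos x + l x" by linarith
  then show ?thesis
  proof cases
    case 1
    then show ?thesis using blowup_le[OF t x] covered_left gx moved_left x by simp
  next
    case 2
    then show ?thesis using blowup_ge[OF t x] covered_right gx moved_right x by simp
  next
    case 3
    then show ?thesis using blowup_in[OF t x] moved_bounds[OF x, of t]
      by (simp add: covered_def clip_def)
  qed
qed

section \<open>The derivative as a uniformly convergent sum of bumps\<close>

definition excess :: "'i \<Rightarrow> real \<Rightarrow> real" where
  "excess x t = yoccoz_slope (l x) (l (g x)) (covered x t) - 1"

lemma continuous_on_covered: "continuous_on S (covered x)"
  unfolding covered_def[abs_def] clip_def[abs_def] by (intro continuous_intros)

lemma continuous_on_moved: "x \<in> X \<Longrightarrow> continuous_on S (moved g x)"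
  unfolding moved_def[abs_def] using l_pos slow_automorphismD(3)[OF g]
  by (intro continuous_on_yoccoz continuous_on_covered) auto

lemma continuous_on_excess: "x \<in> X \<Longrightarrow> continuous_on S (excess x)"
  unfolding excess_def[abs_def] using l_pos slow_automorphismD(3)[OF g]
  by (intro continuous_on_diff continuous_on_yoccoz_slope continuous_on_covered continuous_on_const) auto

text \<open>There \<open>covered x t\<close> is 0 or \<open>l x\<close>, where the Yoccoz slope is
  1. So subtracting 1 turns the slope into a continuous bump on one interval.\<close>

lemma excess_outside:
  assumes "x \<in> X" "t \<le> pos x \<or> pos x + l x \<le> t" shows "excess x t = 0"
  using assms covered_left covered_right l_pos slow_automorphismD(3)[OF g] by (auto simp: excess_def)

lemma excess_bound:
  assumes "x \<in> X" shows "\<bar>excess x t\<bar> \<le> \<bar>(l (g x) / l x)\<^sup>2 - 1\<bar>"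
  unfolding excess_def using assms l_pos slow_automorphismD(3)[OF g] by (intro yoccoz_slope_dist) auto

lemma excess_gt: "x \<in> X \<Longrightarrow> -1 < excess x t"
  unfolding excess_def using l_pos slow_automorphismD(3)[OF g] yoccoz_slope_pos by simp

lemma excess_unique:
  assumes "x \<in> X" "y \<in> X" "excess x t \<noteq> 0" "excess y t \<noteq> 0" shows "x = y"
proof (rule ccontr)
  assume "x \<noteq> y"
  moreover have "pos x < t \<and> t < pos x + l x" using assms(1,3) excess_outside[of x t] by linarith
  moreover have "pos y < t \<and> t < pos y + l y" using assms(2,4) excess_outside[of y t] by linarith
  ultimately show False using intervals_disjoint[OF assms(1,2)] by linarith
qed

lemma excess_integral:
  assumes x: "x \<in> X" and ab: "a \<le> b"
  shows "(excess x has_integral ((moved g x b - covered x b) - (moved g x a - covered x a))) {a..b}"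
\<comment> \<open>\<open>moved\<close> and \<open>covered\<close> have corners at the two ends of
  the interval; continuity is enough at these exceptional points.\<close>
proof (rule fundamental_theorem_of_calculus_interior_strong[of "{pos x, pos x + l x}"])
  have lp: "0 < l x" "0 < l (g x)" using x l_pos slow_automorphismD(3)[OF g] by auto
  fix z assume z: "z \<in> {a<..<b} - {pos x, pos x + l x}"
  then consider "z < pos x" | "pos x + l x < z" | "pos x < z" "z < pos x + l x" by force
  then have "((\<lambda>t. moved g x t - covered x t) has_real_derivative excess x z) (at z)"
  proof cases
    case 1
    have "((\<lambda>t. 0) has_real_derivative excess x z) (at z)"
      using 1 x excess_outside by simp
    then show ?thesis
      by (rule has_field_derivative_transform_within_open[of _ _ _ "{..<pos x}"])
        (use 1 x in \<open>auto simp: moved_left covered_left\<close>)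
  next
    case 2
    have "((\<lambda>t. l (g x) - l x) has_real_derivative excess x z) (at z)"
      using 2 x excess_outside by simp
    then show ?thesis
      by (rule has_field_derivative_transform_within_open[of _ _ _ "{pos x + l x<..}"])
        (use 2 x in \<open>auto simp: moved_right covered_right\<close>)
  next
    case 3
    have covered: "covered x t = t - pos x" if "pos x < t" "t < pos x + l x" for t
      using that by (simp add: covered_def clip_def)
    have "(yoccoz (l x) (l (g x)) has_real_derivative yoccoz_slope (l x) (l (g x)) (z - pos x)) (at (z - pos x))"
      by (rule yoccoz_derivative[OF lp]) (use 3 in auto)
    then have "((\<lambda>t. yoccoz (l x) (l (g x)) (t - pos x)) has_real_derivative
        yoccoz_slope (l x) (l (g x)) (z - pos x) * 1) (at z)"
      by (rule DERIV_chain2) (auto intro!: derivative_eq_intros)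
    then have "((\<lambda>t. yoccoz (l x) (l (g x)) (t - pos x) - (t - pos x)) has_real_derivative excess x z) (at z)"
      unfolding excess_def covered[OF 3] by (auto intro!: derivative_eq_intros)
    then show ?thesis
      by (rule has_field_derivative_transform_within_open[of _ _ _ "{pos x<..<pos x + l x}"])
        (use 3 in \<open>auto simp: moved_def covered\<close>)
  qed
  then show "((\<lambda>t. moved g x t - covered x t) has_vector_derivative excess x z) (at z)"
    by (simp add: has_real_derivative_iff_has_vector_derivative)
qed (use ab x in \<open>auto intro!: continuous_on_diff continuous_on_moved continuous_on_covered\<close>)

definition total_excess :: "real \<Rightarrow> real" where
  "total_excess t = infsum (\<lambda>x. excess x t) X"

lemma total_excess_cases:
  "total_excess t = 0 \<and> (\<forall>x\<in>X. excess x t = 0) \<or> (\<exists>x\<in>X. total_excess t = excess x t \<and> (\<forall>y\<in>X - {x}. excess y t = 0))"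
proof (cases "\<exists>x\<in>X. excess x t \<noteq> 0")
  case True
  then obtain x where x: "x \<in> X" "excess x t \<noteq> 0" by blast
  then have o: "excess y t = 0" if "y \<in> X - {x}" for y using excess_unique that by blast
  have "total_excess t = infsum (\<lambda>x. excess x t) {x}" unfolding total_excess_def
    by (rule infsum_cong_neutral) (use x o in auto)
  then show ?thesis using x o by auto
next
  case False
  then show ?thesis by (auto simp: total_excess_def intro!: infsum_0)
qed

text \<open>
  The functions \<open>excess x\<close> have disjoint supports, and by slowness only finitely many of them
  exceed a given bound.
\<close>
lemma uniform_limit_excess:
  "uniform_limit UNIV (\<lambda>F t. \<Sum>x\<in>F \<inter> X. excess x t) total_excess (finite_subsets_at_top X)"
proof (rule uniform_limitI)
  fix \<epsilon> :: real assume \<epsilon>: "\<epsilon> > 0"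
  \<comment> \<open>Outside this finite set every bump stays below \<open>\<epsilon>\<close>. At a
    given \<open>t\<close> at most one bump is nonzero, so a partial sum containing \<open>B\<close>
    misses at most one small value.\<close>
  define B where "B = {x \<in> X. \<epsilon> \<le> \<bar>(l (g x) / l x)\<^sup>2 - 1\<bar>}"
  have B: "finite B" "B \<subseteq> X" using g \<epsilon> by (auto simp: slow_automorphism_def B_def)
  have "dist (\<Sum>x\<in>F \<inter> X. excess x t) (total_excess t) < \<epsilon>"
    if F: "finite F" "B \<subseteq> F" "F \<subseteq> X" for F t
    using total_excess_cases[of t]
  proof (elim disjE bexE conjE)
    assume "total_excess t = 0" "\<forall>x\<in>X. excess x t = 0"
    then show ?thesis using \<epsilon> by simp
  next
    fix x assume x: "x \<in> X" "total_excess t = excess x t" "\<forall>y\<in>X - {x}. excess y t = 0"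
    \<comment> \<open>Intersecting with \<open>X\<close> makes the partial sum continuous for every
      index \<open>F\<close>, as the limit theorems ask; for the present \<open>F\<close> it is the
      plain sum.\<close>
    have FX: "F \<inter> X = F" using F by blast
    show ?thesis
    proof (cases "x \<in> F")
      case True
      have "(\<Sum>y\<in>F. excess y t) = excess x t + (\<Sum>y\<in>F - {x}. excess y t)"
        using F(1) True by (rule sum.remove)
      also have "(\<Sum>y\<in>F - {x}. excess y t) = 0" using x F by (intro sum.neutral) auto
      finally show ?thesis using x \<epsilon> FX by simp
    next
      case False
      then have "(\<Sum>y\<in>F. excess y t) = 0" using x F by (intro sum.neutral) auto
      moreover have "x \<notin> B" using False F by blast
      then have "\<bar>excess x t\<bar> < \<epsilon>" using excess_bound[OF x(1), of t] x(1) by (simp add: B_def)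
      ultimately show ?thesis using x FX by (simp add: dist_real_def)
    qed
  qed
  then show "\<forall>\<^sub>F F in finite_subsets_at_top X. \<forall>t\<in>UNIV. dist (\<Sum>x\<in>F \<inter> X. excess x t) (total_excess t) < \<epsilon>"
    unfolding eventually_finite_subsets_at_top using B by blast
qed

lemma continuous_on_total_excess: "continuous_on S total_excess"
proof -
  have "continuous_on UNIV total_excess"
    by (rule uniform_limit_theorem[OF _ uniform_limit_excess])
      (auto intro!: always_eventually continuous_on_sum continuous_on_excess)
  then show ?thesis using continuous_on_subset by blast
qed

lemma total_excess_gt: "-1 < total_excess t"
  using total_excess_cases[of t] excess_gt by auto

text \<open>Uniform convergence lets the integral pass through the sum of bumps. Each bump
  integrates to an increment of \<open>moved g x - covered x\<close>, and by
  \<open>blowup_has_sum\<close> these increments sum to the right-hand side; uniqueness of sums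
  finishes.\<close>

lemma total_excess_integral:
  assumes "a \<le> b"
  shows "integral {a..b} total_excess = (blowup g b - b) - (blowup g a - a)"
proof -
  have ul: "uniform_limit {a..b} (\<lambda>F t. \<Sum>x\<in>F \<inter> X. excess x t) total_excess (finite_subsets_at_top X)"
    using uniform_limit_excess by (rule uniform_limit_on_subset) simp
  obtain I J where I: "\<And>F. ((\<lambda>t. \<Sum>x\<in>F \<inter> X. excess x t) has_integral I F) {a..b}"
    and J: "(total_excess has_integral J) {a..b}" and lim: "(I \<longlongrightarrow> J) (finite_subsets_at_top X)"
    by (rule uniform_limit_integral[OF ul]) (auto intro!: continuous_on_sum continuous_on_excess)
  let ?u = "\<lambda>x. (moved g x b - covered x b) - (moved g x a - covered x a)"
  have "I F = sum ?u F" if "finite F" "F \<subseteq> X" for F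
  proof -
    have FX: "F \<inter> X = F" using that by blast
    have "((\<lambda>t. \<Sum>x\<in>F. excess x t) has_integral sum ?u F) {a..b}"
      using that by (intro has_integral_sum excess_integral assms) auto
    then show ?thesis using has_integral_unique[OF I[of F]] unfolding FX by blast
  qed
  then have "\<forall>\<^sub>F F in finite_subsets_at_top X. I F = sum ?u F"
    unfolding eventually_finite_subsets_at_top by blast
  then have "(sum ?u \<longlongrightarrow> J) (finite_subsets_at_top X)" using lim tendsto_cong by blast
  then have "(?u has_sum J) X" by (simp add: has_sum_def)
  moreover have "(?u has_sum (blowup g b - b) - (blowup g a - a)) X"
    by (intro has_sum_diff_real blowup_has_sum)
  ultimately have "J = (blowup g b - b) - (blowup g a - a)" by (rule has_sum_unique)
  then show ?thesis using J by blast
qed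

lemma blowup_derivative: "(blowup g has_real_derivative 1 + total_excess t) (at t)"
proof -
  \<comment> \<open>The ends \<open>t - 1\<close> and \<open>t + 1\<close> put \<open>t\<close> in
    the interior, so the derivative within the interval becomes two-sided.\<close>
  have "((\<lambda>s. integral {t-1..s} total_excess) has_real_derivative total_excess t) (at t within {t-1..t+1})"
    by (rule integral_has_real_derivative) (auto intro: continuous_on_total_excess)
  then have "((\<lambda>s. integral {t-1..s} total_excess) has_real_derivative total_excess t) (at t)"
    by (simp add: at_within_Icc_at)
  then have "((\<lambda>s. integral {t-1..s} total_excess + s + (blowup g (t-1) - (t-1)))
      has_real_derivative 1 + total_excess t) (at t)"
    by (auto intro!: derivative_eq_intros)
  then show ?thesis
    by (rule has_field_derivative_transform_within_open[of _ _ _ "{t-1<..}"])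
      (auto simp: total_excess_integral)
qed

end

lemma blowup_C1:
  assumes "slow_automorphism g"
  obtains D where "continuous_on UNIV D" "\<And>t. 0 < D t" "\<And>t. (blowup g has_real_derivative D t) (at t)"
proof (rule that[of "\<lambda>t. 1 + total_excess g t"])
  show "continuous_on UNIV (\<lambda>t. 1 + total_excess g t)"
    by (intro continuous_on_add continuous_on_const continuous_on_total_excess assms)
  show "0 < 1 + total_excess g t" for t using total_excess_gt[OF assms, of t] by linarith
qed (rule blowup_derivative[OF assms])

text \<open>The cocycle property matches the term of \<open>g\<close> at \<open>h x\<close> with the
  term of \<open>k\<close> at \<open>x\<close>, and reindexing by \<open>h\<close> matches the sums.
  The separate \<open>k\<close> is there because left translation by a product agrees with the
  composite of translations only on \<open>X\<close>.\<close>

lemma blowup_compose: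
  assumes g: "slow_automorphism g" and h: "slow_automorphism h" and k: "slow_automorphism k"
    and gh: "\<And>x. x \<in> X \<Longrightarrow> k x = g (h x)"
  shows "blowup g (blowup h t) = blowup k t"
proof (cases "0 \<le> t \<and> t \<le> 1")
  case True
  then have t: "0 \<le> t" "t \<le> 1" by auto
  have "moved g (h x) (blowup h t) = moved k x t" if x: "x \<in> X" for x
  proof -
    have hx: "h x \<in> X" "0 < l (h x)" using slow_automorphismD[OF h] x by auto
    have "moved g (h x) (blowup h t) = yoccoz (l (h x)) (l (g (h x))) (moved h x t)"
      by (simp only: moved_def[of g] covered_blowup[OF h t x])
    also have "\<dots> = moved k x t"
      using yoccoz_cocycle[OF l_pos[OF x] hx(2) slow_automorphismD(3)[OF g hx(1)]] by (simp only: moved_def gh[OF x])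
    finally show ?thesis .
  qed
  then have "infsum (\<lambda>x. moved k x t) X = infsum (\<lambda>x. moved g (h x) (blowup h t)) X"
    by (intro infsum_cong) simp
  also have "\<dots> = infsum (\<lambda>x. moved g x (blowup h t)) X"
    by (rule infsum_reindex_bij_betw[OF slow_automorphismD(1)[OF h]])
  finally show ?thesis using blowup_eq[OF g blowup_range[OF h t]] blowup_eq[OF k t] by simp
next
  case False
  then have t: "t \<le> 0 \<or> 1 \<le> t" by auto
  show ?thesis using blowup_outside[OF _ t] g h k by simp
qed

lemma blowup_id:
  assumes "\<And>x. x \<in> X \<Longrightarrow> g x = x" shows "blowup g t = t"
proof -
  have "infsum (\<lambda>x. moved g x t - covered x t) X = 0"
    using assms l_pos covered_bounds by (intro infsum_0) (simp add: moved_def yoccoz_refl)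
  then show ?thesis by (simp add: blowup_def)
qed

text \<open>The blow-up sends the left endpoint of the interval of \<open>x\<close> to that of
  \<open>g x\<close>, and different intervals of positive length have different left
  endpoints.\<close>

lemma blowup_inject:
  assumes g: "slow_automorphism g" and h: "slow_automorphism h" and eq: "blowup g = blowup h" and x: "x \<in> X"
  shows "g x = h x"
proof (rule ccontr)
  assume ne: "g x \<noteq> h x"
  have t: "0 \<le> pos x" "pos x \<le> 1" using pos_nonneg pos_le_1 l_pos x by (force)+
  have "pos (f x) = blowup f (pos x)" if "slow_automorphism f" for f
    using blowup_in[OF that t x] moved_left[OF that order_refl x] l_pos[OF x] by simp
  then have "pos (g x) = pos (h x)" using g h eq by metis
  then show False
    using intervals_disjoint[OF _ _ ne] slow_automorphismD[OF g] slow_automorphismD[OF h] x by force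
qed

end

section \<open>Actions supported in the unit interval\<close>

lemma iso_subgroup_if_inj_hom:
  assumes G: "group G" and D: "group D" and h: "h \<in> hom G D" and inj: "inj_on h (carrier G)"
  shows "\<exists>H. subgroup H D \<and> G \<cong> D \<lparr>carrier := H\<rparr>"
proof (intro exI conjI)
  interpret group_hom G D h by (rule group_hom.intro[OF G D group_hom_axioms.intro[OF h]])
  show "subgroup (h ` carrier G) D" by (rule img_is_subgroup)
  have "h \<in> iso G (D \<lparr>carrier := h ` carrier G\<rparr>)"
    using h inj by (auto simp: iso_def hom_def bij_betw_def)
  then show "G \<cong> D \<lparr>carrier := h ` carrier G\<rparr>" by (rule is_isoI)
qed

lemma Arg2pi_cis: "0 \<le> t \<Longrightarrow> t < 2 * pi \<Longrightarrow> Arg2pi (cis t) = t"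
  by (rule Arg2pi_unique[of 1]) (simp_all add: cis_conv_exp)

text \<open>Derivatives are unique, so local formulas for them agree on overlaps and glue. This
  serves circle maps, for which formulas are available only on arcs of parameters.\<close>

lemma C1_within_UNIV_local:
  assumes "\<And>t. \<exists>U F. open U \<and> t \<in> U \<and> continuous_on U F \<and> (\<forall>s\<in>U. (f has_vector_derivative F s) (at s))"
  shows "C1_within f UNIV"
  unfolding C1_within_def
proof (intro exI conjI ballI)
  let ?f' = "\<lambda>t. vector_derivative f (at t)"
  show "(f has_vector_derivative ?f' t) (at t within UNIV)" for t
    using assms[of t] vector_derivative_at by fastforce
  have "isCont ?f' t" for t
  proof -
    obtain U F where U: "open U" "t \<in> U" "continuous_on U F" "\<And>s. s \<in> U \<Longrightarrow> (f has_vector_derivative F s) (at s)"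
      using assms[of t] by blast
    have "continuous_on U ?f'"
      using U(3) by (rule continuous_on_eq) (use U(4) vector_derivative_at in metis)
    then show ?thesis using U(1,2) continuous_on_eq_continuous_at by blast
  qed
  then show "continuous_on UNIV ?f'" by (simp add: continuous_on_eq_continuous_at)
qed

locale unit_interval_action = group G for G (structure) +
  fixes \<Phi> :: "'a \<Rightarrow> real \<Rightarrow> real"
  assumes act_one: "\<Phi> \<one> t = t"
    and act_mult: "g \<in> carrier G \<Longrightarrow> h \<in> carrier G \<Longrightarrow> \<Phi> (g \<otimes> h) t = \<Phi> g (\<Phi> h t)"
    and act_C1: "g \<in> carrier G \<Longrightarrow>
      \<exists>D. continuous_on UNIV D \<and> (\<forall>t. 0 < D t) \<and> (\<forall>t. (\<Phi> g has_real_derivative D t) (at t))"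
    and act_outside: "g \<in> carrier G \<Longrightarrow> t \<le> 0 \<or> 1 \<le> t \<Longrightarrow> \<Phi> g t = t"
    and act_range: "g \<in> carrier G \<Longrightarrow> 0 \<le> t \<Longrightarrow> t \<le> 1 \<Longrightarrow> 0 \<le> \<Phi> g t \<and> \<Phi> g t \<le> 1"
    and act_faithful: "g \<in> carrier G \<Longrightarrow> h \<in> carrier G \<Longrightarrow> \<Phi> g = \<Phi> h \<Longrightarrow> g = h"
begin

lemma act_inv:
  assumes "g \<in> carrier G"
  shows "\<Phi> (inv g) (\<Phi> g t) = t" "\<Phi> g (\<Phi> (inv g) t) = t"
  using act_mult[of "inv g" g t] act_mult[of g "inv g" t] assms by (simp_all add: act_one)

lemma act_faithful_unit:
  assumes "g \<in> carrier G" "h \<in> carrier G" and eq: "\<And>t. 0 \<le> t \<Longrightarrow> t \<le> 1 \<Longrightarrow> \<Phi> g t = \<Phi> h t"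
  shows "g = h"
proof (rule act_faithful[OF assms(1,2)], rule ext)
  fix t show "\<Phi> g t = \<Phi> h t"
    using eq[of t] act_outside[OF assms(1), of t] act_outside[OF assms(2), of t] by linarith
qed

text \<open>Serves both the line and the interval. The inverse of a map is the map of the inverse
  element, so its smoothness comes from the action itself and not from an inverse function
  theorem.\<close>

lemma embeds_Diff1_real:
  assumes S: "{0..1} \<subseteq> S" and inv: "\<And>g t. g \<in> carrier G \<Longrightarrow> t \<in> S \<Longrightarrow> \<Phi> g t \<in> S"
    and grp: "group (Diff1_real S)"
  shows "\<exists>H. subgroup H (Diff1_real S) \<and> G \<cong> Diff1_real S \<lparr>carrier := H\<rparr>"
proof (rule iso_subgroup_if_inj_hom[OF is_group grp])
  define \<rho> where "\<rho> g = (\<lambda>t\<in>S. \<Phi> g t)" for g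
  have Bij: "\<rho> g \<in> Bij S" if "g \<in> carrier G" for g
  proof -
    have "bij_betw (\<rho> g) S S"
      by (rule bij_betw_byWitness[where f' = "\<Phi> (inv g)"])
        (use that act_inv inv in \<open>auto simp: \<rho>_def\<close>)
    then show ?thesis by (simp add: Bij_def \<rho>_def)
  qed
  have C1: "C1_within (\<Phi> g) S" if g: "g \<in> carrier G" for g
  proof -
    obtain D where "continuous_on UNIV D" "\<And>t. (\<Phi> g has_real_derivative D t) (at t)"
      using act_C1[OF g] by blast
    then show ?thesis unfolding C1_within_def
      by (intro exI[of _ D])
        (auto simp flip: has_real_derivative_iff_has_vector_derivative
          intro: has_field_derivative_at_within continuous_on_subset)
  qed
  have carr: "\<rho> g \<in> Diff1_real_carrier S" if g: "g \<in> carrier G" for g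
    unfolding Diff1_real_carrier_def mem_Collect_eq
  proof (intro conjI ballI)
    show "C1_within (\<rho> g) S" using C1[OF g] C1_within_cong[of S "\<rho> g" "\<Phi> g"] by (simp add: \<rho>_def)
    have "inv_into S (\<rho> g) t = \<Phi> (inv g) t" if "t \<in> S" for t
      by (rule inv_into_f_eq)
        (use Bij[OF g] that g inv act_inv in \<open>auto simp: \<rho>_def Bij_def bij_betw_def\<close>)
    then show "C1_within (inv_into S (\<rho> g)) S"
      using C1[of "inv g"] g C1_within_cong[of S "inv_into S (\<rho> g)" "\<Phi> (inv g)"] by simp
    fix t assume t: "t \<in> S"
    obtain D where "\<And>t. 0 < D t" "\<And>t. (\<Phi> g has_real_derivative D t) (at t)"
      using act_C1[OF g] by blast
    then show "\<exists>d>0. (\<rho> g has_real_derivative d) (at t within S)"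
      using real_derivative_transform[OF t, of "\<rho> g" "\<Phi> g" "D t"]
      by (auto simp: \<rho>_def intro!: exI[of _ "D t"] intro: has_field_derivative_at_within)
  qed (rule Bij[OF g])
  show "\<rho> \<in> hom G (Diff1_real S)"
  proof (rule homI)
    show "\<rho> g \<in> carrier (Diff1_real S)" if "g \<in> carrier G" for g
      using carr[OF that] by (simp add: Diff1_real_def)
    show "\<rho> (g \<otimes> h) = \<rho> g \<otimes>\<^bsub>Diff1_real S\<^esub> \<rho> h" if "g \<in> carrier G" "h \<in> carrier G" for g h
      using Bij that inv act_mult
      by (auto simp: Diff1_real_def BijGroup_def compose_def \<rho>_def fun_eq_iff restrict_def)
  qed
  show "inj_on \<rho> (carrier G)"
  proof (rule inj_onI)
    fix g h assume gh: "g \<in> carrier G" "h \<in> carrier G" "\<rho> g = \<rho> h"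
    then show "g = h"
      using S by (intro act_faithful_unit) (auto simp: \<rho>_def fun_eq_iff restrict_def split: if_splits)
  qed
qed

text \<open>The parameters in \<open>(1 - 2 * pi, 0)\<close> and in \<open>(1, 2 * pi)\<close>
  describe the same arc and are all fixed by the action. Hence on both sides of the seam
  \<open>cis 0\<close> the circle map is read off from one smooth map of the line.\<close>

lemma embeds_Diff1_circle: "\<exists>H. subgroup H Diff1_circle \<and> G \<cong> Diff1_circle \<lparr>carrier := H\<rparr>"
proof (rule iso_subgroup_if_inj_hom[OF is_group group_Diff1_circle])
  define \<rho> where "\<rho> g = (\<lambda>z\<in>circle. cis (\<Phi> g (Arg2pi z)))" for g
  have range: "0 \<le> \<Phi> g s" "\<Phi> g s < 2 * pi" if "g \<in> carrier G" "0 \<le> s" "s < 2 * pi" for g s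
    using act_range[OF that(1,2)] act_outside[OF that(1), of s] that(2,3) pi_gt3
    by (cases "s \<le> 1"; force)+
  \<comment> \<open>This range of \<open>s\<close> is an open interval longer than a period, so it gives local formulas everywhere.\<close>
  have \<rho>_cis: "\<rho> g (cis s) = cis (\<Phi> g s)" if "g \<in> carrier G" "1 - 2 * pi < s" "s < 2 * pi" for g s
  proof (cases "0 \<le> s")
    case True
    then show ?thesis using that by (simp add: \<rho>_def Arg2pi_cis)
  next
    case False
    have "cis s = cis (s + 2 * pi)" by (simp add: cis.ctr)
    moreover have "Arg2pi (cis (s + 2 * pi)) = s + 2 * pi" using False that pi_gt3 by (intro Arg2pi_cis) auto
    ultimately have "\<rho> g (cis s) = cis (\<Phi> g (s + 2 * pi))" by (simp add: \<rho>_def)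
    \<comment> \<open>Both \<open>s < 0\<close> and \<open>s + 2 * pi > 1\<close> are fixed, so the
      two branches give the same point.\<close>
    then show ?thesis using act_outside[OF that(1)] False that by (simp add: cis.ctr)
  qed
  have ex: "\<exists>s. 0 \<le> s \<and> s < 2 * pi \<and> z = cis s" if "z \<in> circle" for z
    using that Arg2pi[of z] by (intro exI[of _ "Arg2pi z"]) (auto simp: cis_conv_exp is_Arg_def)
  have comp: "\<rho> (g \<otimes> h) z = \<rho> g (\<rho> h z)" if gh: "g \<in> carrier G" "h \<in> carrier G" and z: "z \<in> circle" for g h z
  proof -
    obtain s where s: "0 \<le> s" "s < 2 * pi" "z = cis s" using ex[OF z] by blast
    then show ?thesis using \<rho>_cis[of _ s] \<rho>_cis[of g "\<Phi> h s"] range[OF gh(2) s(1,2)] gh pi_gt3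
      by (simp add: act_mult)
  qed
  have one: "\<rho> \<one> z = z" if z: "z \<in> circle" for z
    using ex[OF z] by (auto simp: \<rho>_def act_one Arg2pi_cis)
  have inv1: "\<rho> (inv g) (\<rho> g z) = z" if "g \<in> carrier G" "z \<in> circle" for g z
    using comp[of "inv g" g z] that one by simp
  have circ: "\<rho> g z \<in> circle" if "z \<in> circle" for g z
    using that by (simp add: \<rho>_def)
  have Bij: "\<rho> g \<in> Bij circle" if g: "g \<in> carrier G" for g
  proof -
    have "bij_betw (\<rho> g) circle circle"
      by (rule bij_betw_byWitness[where f' = "\<rho> (inv g)"])
        (use inv1[OF g] inv1[of "inv g"] g circ in auto)
    then show ?thesis by (simp add: Bij_def \<rho>_def)
  qed
  have period: "\<exists>k::int. 0 \<le> t + 2 * pi * k \<and> t + 2 * pi * k < 2 * pi" for t :: real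
  proof -
    have "0 \<le> t / (2 * pi) - \<lfloor>t / (2 * pi)\<rfloor>" "t / (2 * pi) - \<lfloor>t / (2 * pi)\<rfloor> < 1"
      by linarith+
    then have "0 \<le> (t / (2 * pi) - \<lfloor>t / (2 * pi)\<rfloor>) * (2 * pi)"
      "(t / (2 * pi) - \<lfloor>t / (2 * pi)\<rfloor>) * (2 * pi) < 1 * (2 * pi)"
      by (intro mult_nonneg_nonneg mult_strict_right_mono; simp)+
    then show ?thesis by (intro exI[of _ "- \<lfloor>t / (2 * pi)\<rfloor>"]) (simp add: algebra_simps)
  qed
  have local: "\<exists>U D. open U \<and> t \<in> U \<and> continuous_on U D \<and> continuous_on U (\<lambda>s. \<rho> g (cis s)) \<and> (\<forall>s\<in>U. 0 < D s
      \<and> ((\<lambda>s. \<rho> g (cis s)) has_vector_derivative (D s *\<^sub>R (\<i> * \<rho> g (cis s)))) (at s))"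
    if g: "g \<in> carrier G" for g and t :: real
  proof -
    obtain D where D: "continuous_on UNIV D" "\<And>t. 0 < D t" "\<And>t. (\<Phi> g has_real_derivative D t) (at t)"
      using act_C1[OF g] by blast
    obtain k :: int where k: "0 \<le> t + 2 * pi * k" "t + 2 * pi * k < 2 * pi" using period by blast
    \<comment> \<open>The translate of the parameter range of \<open>\<rho>_cis\<close> that
      contains \<open>t\<close>.\<close>
    let ?U = "{1 - 2 * pi - 2 * pi * k<..<2 * pi - 2 * pi * k}"
    have eq: "\<rho> g (cis s) = cis (\<Phi> g (s + 2 * pi * k))" if "s \<in> ?U" for s
    proof -
      have "cis s = cis (s + 2 * pi * k)"
        by (simp add: cis_mult[symmetric] cis_multiple_2pi)
      then show ?thesis using \<rho>_cis[OF g, of "s + 2 * pi * k"] that by simp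
    qed
    have der: "((\<lambda>s. \<rho> g (cis s)) has_vector_derivative (D (s + 2 * pi * k) *\<^sub>R (\<i> * \<rho> g (cis s)))) (at s)"
      if s: "s \<in> ?U" for s
    proof -
      have "((\<lambda>s. \<Phi> g (s + 2 * pi * k)) has_real_derivative D (s + 2 * pi * k) * 1) (at s)"
        by (rule DERIV_chain2[OF D(3)]) (auto intro!: derivative_eq_intros)
      then have "((\<lambda>s. \<Phi> g (s + 2 * pi * k)) has_vector_derivative D (s + 2 * pi * k)) (at s)"
        by (simp add: has_real_derivative_iff_has_vector_derivative)
      from vector_diff_chain_at[OF this cis_derivative]
      have "((\<lambda>s. cis (\<Phi> g (s + 2 * pi * k))) has_vector_derivative
          (D (s + 2 * pi * k) *\<^sub>R (\<i> * cis (\<Phi> g (s + 2 * pi * k))))) (at s)"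
        by (simp add: o_def)
      then have "((\<lambda>s. \<rho> g (cis s)) has_vector_derivative
          (D (s + 2 * pi * k) *\<^sub>R (\<i> * cis (\<Phi> g (s + 2 * pi * k))))) (at s)"
        by (rule has_vector_derivative_transform_within_open[of _ _ _ ?U]) (use s eq in auto)
      then show ?thesis using eq[OF s] by simp
    qed
    show ?thesis
    proof (intro exI conjI ballI)
      show "t \<in> ?U" using k pi_gt3 by auto
      show "continuous_on ?U (\<lambda>s. D (s + 2 * pi * k))"
        by (intro continuous_on_compose2[OF D(1)] continuous_intros) auto
      show "continuous_on ?U (\<lambda>s. \<rho> g (cis s))"
        using der has_vector_derivative_continuous continuous_at_imp_continuous_on by blast
    qed (use der D in auto)
  qed
  have C1: "C1_circle (\<rho> g)" if g: "g \<in> carrier G" for g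
    unfolding C1_circle_def
  proof (rule C1_within_UNIV_local)
    fix t
    obtain U D where U: "open U" "t \<in> U" "continuous_on U D" "continuous_on U (\<lambda>s. \<rho> g (cis s))"
      "\<And>s. s \<in> U \<Longrightarrow> ((\<lambda>s. \<rho> g (cis s)) has_vector_derivative (D s *\<^sub>R (\<i> * \<rho> g (cis s)))) (at s)"
      using local[OF g, of t] by blast
    then show "\<exists>U F. open U \<and> t \<in> U \<and> continuous_on U F
        \<and> (\<forall>s\<in>U. ((\<lambda>s. \<rho> g (cis s)) has_vector_derivative F s) (at s))"
      by (intro exI[of _ U] exI[of _ "\<lambda>s. D s *\<^sub>R (\<i> * \<rho> g (cis s))"]) (auto intro!: continuous_intros)
  qed
  have carr: "\<rho> g \<in> Diff1_circle_carrier" if g: "g \<in> carrier G" for g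
    unfolding Diff1_circle_carrier_def mem_Collect_eq
  proof (intro conjI allI)
    have "inv_into circle (\<rho> g) z = \<rho> (inv g) z" if "z \<in> circle" for z
      by (rule inv_into_f_eq)
        (use Bij[OF g] that g circ inv1[of "inv g" z] in \<open>auto simp: Bij_def bij_betw_def\<close>)
    then show "C1_circle (inv_into circle (\<rho> g))"
      using C1[of "inv g"] g C1_circle_cong[of "inv_into circle (\<rho> g)" "\<rho> (inv g)"] by simp
    show "\<exists>d>0. ((\<lambda>s. \<rho> g (cis s)) has_vector_derivative (d *\<^sub>R (\<i> * \<rho> g (cis t)))) (at t)" for t
      using local[OF g, of t] by blast
  qed (use Bij C1 g in auto)
  show "\<rho> \<in> hom G Diff1_circle"
  proof (rule homI)
    show "\<rho> g \<in> carrier Diff1_circle" if "g \<in> carrier G" for g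
      using carr[OF that] by (simp add: Diff1_circle_def)
    show "\<rho> (g \<otimes> h) = \<rho> g \<otimes>\<^bsub>Diff1_circle\<^esub> \<rho> h" if gh: "g \<in> carrier G" "h \<in> carrier G" for g h
    proof -
      have "\<rho> g \<otimes>\<^bsub>Diff1_circle\<^esub> \<rho> h = compose circle (\<rho> g) (\<rho> h)"
        using Bij gh by (simp add: Diff1_circle_def BijGroup_def)
      moreover have "\<rho> (g \<otimes> h) z = compose circle (\<rho> g) (\<rho> h) z" for z
      proof (cases "z \<in> circle")
        case True
        then show ?thesis using comp[OF gh] by (simp add: compose_def)
      next
        case False
        then show ?thesis by (simp add: compose_def \<rho>_def)
      qed
      ultimately show ?thesis by auto
    qed
  qed
  show "inj_on \<rho> (carrier G)"
  proof (rule inj_onI)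
    fix g h assume gh: "g \<in> carrier G" "h \<in> carrier G" "\<rho> g = \<rho> h"
    show "g = h"
    proof (rule act_faithful_unit[OF gh(1,2)])
      fix t :: real assume t: "0 \<le> t" "t \<le> 1"
      then have t': "t < 2 * pi" "1 - 2 * pi < t" using pi_gt3 by auto
      have "cis (\<Phi> g t) = cis (\<Phi> h t)"
        using \<rho>_cis[OF gh(1) t'(2,1)] \<rho>_cis[OF gh(2) t'(2,1)] gh(3) by simp
      then have "Arg2pi (cis (\<Phi> g t)) = Arg2pi (cis (\<Phi> h t))" by (rule arg_cong)
      then show "\<Phi> g t = \<Phi> h t"
        unfolding Arg2pi_cis[OF range[OF gh(1) t(1) t'(1)]] Arg2pi_cis[OF range[OF gh(2) t(1) t'(1)]] .
    qed
  qed
qed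

end

section \<open>Left orders on torsion-free nilpotent groups\<close>

context group
begin

lemma mult_inv_cancel_left [simp]:
  "x \<in> carrier G \<Longrightarrow> y \<in> carrier G \<Longrightarrow> x \<otimes> (inv x \<otimes> y) = y"
  "x \<in> carrier G \<Longrightarrow> y \<in> carrier G \<Longrightarrow> inv x \<otimes> (x \<otimes> y) = y"
  by (simp_all flip: m_assoc)

text \<open>Centrality modulo the previous term is expressed by commutators, so that no quotient
  groups are formed.\<close>

primrec upper_central :: "nat \<Rightarrow> 'a set" where
  "upper_central 0 = {\<one>}"
| "upper_central (Suc n) =
     {x \<in> carrier G. \<forall>y\<in>carrier G. x \<otimes> y \<otimes> inv x \<otimes> inv y \<in> upper_central n}"

text \<open>With \<open>[x, y]\<close> for the commutator, the three closure properties rest on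
  \<open>[x y, z] = x [y, z] x\<inverse> [x, z]\<close>,
  \<open>[x\<inverse>, z] = x\<inverse> [x, z]\<inverse> x\<close> and
  \<open>[g x g\<inverse>, y] = g [x, g\<inverse> y g] g\<inverse>\<close>. Each needs normality of
  the previous term, so normality is carried through the induction.\<close>

lemma upper_central_normal: "upper_central n \<lhd> G"
proof (induction n)
  case 0
  show ?case using one_is_normal by simp
next
  case (Suc n)
  interpret N: normal "upper_central n" G by (rule Suc)
  have conj: "g \<otimes> x \<otimes> inv g \<in> upper_central n" if "x \<in> upper_central n" "g \<in> carrier G" for x g
    using Suc that by (simp add: normal_inv_iff)
  show ?case unfolding normal_inv_iff
  proof (intro conjI ballI)
    show "subgroup (upper_central (Suc n)) G"
    proof
      fix x y assume xy: "x \<in> upper_central (Suc n)" "y \<in> upper_central (Suc n)"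
      have "x \<otimes> y \<otimes> z \<otimes> inv (x \<otimes> y) \<otimes> inv z \<in> upper_central n" if z: "z \<in> carrier G" for z
      proof -
        have "x \<otimes> y \<otimes> z \<otimes> inv (x \<otimes> y) \<otimes> inv z
            = (x \<otimes> (y \<otimes> z \<otimes> inv y \<otimes> inv z) \<otimes> inv x) \<otimes> (x \<otimes> z \<otimes> inv x \<otimes> inv z)"
          using xy z by (simp add: m_assoc inv_mult_group)
        then show ?thesis using xy z conj by simp
      qed
      then show "x \<otimes> y \<in> upper_central (Suc n)" using xy by simp
    next
      fix x assume x: "x \<in> upper_central (Suc n)"
      have "inv x \<otimes> z \<otimes> inv (inv x) \<otimes> inv z \<in> upper_central n" if z: "z \<in> carrier G" for z
      proof -
        have "inv x \<otimes> z \<otimes> inv (inv x) \<otimes> inv z = inv x \<otimes> inv (x \<otimes> z \<otimes> inv x \<otimes> inv z) \<otimes> inv (inv x)"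
          using x z by (simp add: m_assoc inv_mult_group)
        then show ?thesis using x z conj[of "inv (x \<otimes> z \<otimes> inv x \<otimes> inv z)" "inv x"] by simp
      qed
      then show "inv x \<in> upper_central (Suc n)" using x by simp
    qed (auto simp: m_assoc)
  next
    fix g x assume gx: "g \<in> carrier G" "x \<in> upper_central (Suc n)"
    have "g \<otimes> x \<otimes> inv g \<otimes> y \<otimes> inv (g \<otimes> x \<otimes> inv g) \<otimes> inv y \<in> upper_central n"
      if y: "y \<in> carrier G" for y
    proof -
      have "g \<otimes> x \<otimes> inv g \<otimes> y \<otimes> inv (g \<otimes> x \<otimes> inv g) \<otimes> inv y
          = g \<otimes> (x \<otimes> (inv g \<otimes> y \<otimes> g) \<otimes> inv x \<otimes> inv (inv g \<otimes> y \<otimes> g)) \<otimes> inv g"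
        using gx y by (simp add: m_assoc inv_mult_group)
      then show ?thesis using gx y conj by simp
    qed
    then show "g \<otimes> x \<otimes> inv g \<in> upper_central (Suc n)" using gx by simp
  qed
qed

lemma upper_central_subgroup: "subgroup (upper_central n) G"
  using upper_central_normal by (rule normal_imp_subgroup)

lemma upper_central_carrier: "x \<in> upper_central n \<Longrightarrow> x \<in> carrier G"
  by (rule subgroup.mem_carrier[OF upper_central_subgroup])

lemma upper_central_conj:
  "x \<in> upper_central n \<Longrightarrow> g \<in> carrier G \<Longrightarrow> g \<otimes> x \<otimes> inv g \<in> upper_central n"
  using upper_central_normal by (simp add: normal_inv_iff)

lemma upper_central_commutator:
  "x \<in> upper_central (Suc n) \<Longrightarrow> y \<in> carrier G \<Longrightarrow> x \<otimes> y \<otimes> inv x \<otimes> inv y \<in> upper_central n"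
  by simp

lemma upper_central_Suc: "upper_central n \<subseteq> upper_central (Suc n)"
proof
  fix x assume x: "x \<in> upper_central n"
  interpret subgroup "upper_central n" G by (rule upper_central_subgroup)
  have "x \<otimes> (y \<otimes> inv x \<otimes> inv y) \<in> upper_central n" if "y \<in> carrier G" for y
    using x that by (intro m_closed upper_central_conj) auto
  then show "x \<in> upper_central (Suc n)" using upper_central_carrier[OF x] by (simp add: m_assoc)
qed

lemma upper_central_mono: "m \<le> n \<Longrightarrow> upper_central m \<subseteq> upper_central n"
  using upper_central_Suc by (rule lift_Suc_mono_le)

text \<open>The two series are compared from opposite ends: commutators with term
  \<open>c - Suc i\<close> of the lower series lie in term \<open>c - i\<close>, hence by induction
  in term \<open>i\<close> of the upper one.\<close>

lemma nilpotent_imp_upper_central: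
  assumes "nilpotent_group G"
  obtains c where "upper_central c = carrier G"
proof -
  obtain c where c: "lower_central_series G c = {\<one>}"
    using assms by (auto simp: nilpotent_group_def)
  have sub: "lower_central_series G n \<subseteq> carrier G" for n
  proof (induction n)
    case (Suc n)
    then show ?case unfolding lower_central_series.simps by (intro generate_incl) auto
  qed simp
  have "lower_central_series G (c - i) \<subseteq> upper_central i" if "i \<le> c" for i
    using that
  proof (induction i)
    case (Suc i)
    have S: "c - i = Suc (c - Suc i)" using Suc by simp
    have "x \<otimes> y \<otimes> inv x \<otimes> inv y \<in> lower_central_series G (c - i)"
      if "x \<in> lower_central_series G (c - Suc i)" "y \<in> carrier G" for x y
      unfolding S lower_central_series.simps by (rule generate.incl) (use that in blast)
    then show ?case using Suc sub by fastforce
  qed (use c in simp)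
  from this[of c] show ?thesis using that[of c] upper_central_carrier by auto
qed

text \<open>The map \<open>x \<mapsto> [x, y]\<close> is a homomorphism from one layer of the series to the layer below.\<close>
lemma upper_central_commutator_pow:
  assumes x: "x \<in> upper_central (Suc (Suc i))" and y: "y \<in> carrier G"
  defines "c \<equiv> x \<otimes> y \<otimes> inv x \<otimes> inv y"
  shows "\<exists>z\<in>upper_central i. x [^] n \<otimes> y \<otimes> inv (x [^] n) \<otimes> inv y = z \<otimes> c [^] (n::nat)"
proof (induction n)
  case 0
  then show ?case using y subgroup.one_closed[OF upper_central_subgroup] by (auto intro!: bexI[of _ \<one>])
next
  case (Suc n)
  have cS: "c \<in> upper_central (Suc i)" using x y by (simp add: c_def)
  have cc: "c \<in> carrier G" using cS by simp
  have xc: "x \<in> carrier G" using x by simp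
  obtain z where z: "z \<in> upper_central i"
    "x [^] n \<otimes> y \<otimes> inv (x [^] n) \<otimes> inv y = z \<otimes> c [^] n" using Suc by blast
  have zc: "z \<in> carrier G" using z upper_central_carrier by blast
  \<comment> \<open>The cost of moving \<open>c\<close> past \<open>x [^] n\<close>. It lies in term
    \<open>i\<close> because \<open>c\<close> is central modulo that term.\<close>
  define d where "d = inv (c \<otimes> x [^] n \<otimes> inv c \<otimes> inv (x [^] n))"
  interpret U: subgroup "upper_central i" G by (rule upper_central_subgroup)
  have d: "d \<in> upper_central i" using cS xc by (simp add: d_def)
  have "x [^] Suc n \<otimes> y \<otimes> inv (x [^] Suc n) \<otimes> inv y
      = (x [^] n \<otimes> c \<otimes> inv (x [^] n)) \<otimes> (x [^] n \<otimes> y \<otimes> inv (x [^] n) \<otimes> inv y)"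
    using xc y by (simp add: m_assoc inv_mult_group c_def)
  also have "x [^] n \<otimes> c \<otimes> inv (x [^] n) = d \<otimes> c"
    using xc cc by (simp add: m_assoc inv_mult_group d_def)
  also have "d \<otimes> c \<otimes> (x [^] n \<otimes> y \<otimes> inv (x [^] n) \<otimes> inv y) = (d \<otimes> (c \<otimes> z \<otimes> inv c)) \<otimes> (c \<otimes> c [^] n)"
    using z zc d cc by (simp add: m_assoc)
  also have "c \<otimes> c [^] n = c [^] Suc n"
    using nat_pow_Suc2[OF cc] by simp
  finally show ?case
    using d z cc upper_central_conj by (intro bexI[of _ "d \<otimes> (c \<otimes> z \<otimes> inv c)"]) auto
qed

text \<open>Torsion-freeness climbs from the bottom layer. If \<open>x [^] n\<close> is one term
  lower, then by the power formula so is the \<open>n\<close>-th power of \<open>[x, y]\<close>; the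
  induction hypothesis lowers \<open>[x, y]\<close> itself, for every \<open>y\<close>.\<close>

lemma upper_central_isolated:
  assumes "torsion_free_group G" "n > 0"
  shows "x \<in> upper_central (Suc i) \<Longrightarrow> x [^] (n::nat) \<in> upper_central i \<Longrightarrow> x \<in> upper_central i"
proof (induction i arbitrary: x)
  case 0
  then have "x \<in> carrier G" "x [^] n = \<one>" by simp_all
  then have "x = \<one>" using assms unfolding torsion_free_group_def by blast
  then show ?case by simp
next
  case (Suc i)
  have xc: "x \<in> carrier G" using Suc.prems by simp
  have "x \<otimes> y \<otimes> inv x \<otimes> inv y \<in> upper_central i" if y: "y \<in> carrier G" for y
  proof (rule Suc.IH)
    let ?c = "x \<otimes> y \<otimes> inv x \<otimes> inv y"
    show "?c \<in> upper_central (Suc i)" using Suc.prems y by simp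
    interpret U: subgroup "upper_central i" G by (rule upper_central_subgroup)
    obtain z where z: "z \<in> upper_central i"
      "x [^] n \<otimes> y \<otimes> inv (x [^] n) \<otimes> inv y = z \<otimes> ?c [^] n"
      using upper_central_commutator_pow[OF Suc.prems(1) y] by blast
    have "z \<otimes> ?c [^] n \<in> upper_central i" using Suc.prems(2) y unfolding z(2)[symmetric] by simp
    then have "inv z \<otimes> (z \<otimes> ?c [^] n) \<in> upper_central i" using z by blast
    moreover have "inv z \<otimes> (z \<otimes> ?c [^] n) = ?c [^] n" using z(1) xc y by simp
    ultimately show "?c [^] n \<in> upper_central i" by simp
  qed
  then show ?case using xc by simp
qed

text \<open>A torsion-free abelian group can be ordered; here it is the quotient of \<open>K\<close>
  by \<open>H\<close>, written without cosets. Zorn's lemma gives a maximal subsemigroup that avoids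
  \<open>H\<close> and is stable under it, and maximality makes it total.\<close>

lemma torsion_free_abelian_layer_cone:
  assumes K: "subgroup K G" and H: "subgroup H G"
    and ab: "\<And>x y. x \<in> K \<Longrightarrow> y \<in> K \<Longrightarrow> \<exists>h\<in>H. x \<otimes> y = y \<otimes> x \<otimes> h"
    and isol: "\<And>x n. x \<in> K \<Longrightarrow> 0 < n \<Longrightarrow> x [^] (n::nat) \<in> H \<Longrightarrow> x \<in> H"
    and HK: "H \<subseteq> K"
  shows "\<exists>Q\<subseteq>K. Q \<inter> H = {} \<and> (\<forall>x\<in>Q. \<forall>y\<in>Q. x \<otimes> y \<in> Q) \<and> (\<forall>x\<in>Q. \<forall>h\<in>H. x \<otimes> h \<in> Q \<and> h \<otimes> x \<in> Q)
    \<and> (\<forall>x\<in>K. x \<in> H \<or> x \<in> Q \<or> inv x \<in> Q)"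
proof -
  interpret K: subgroup K G by fact
  interpret H: subgroup H G by fact
  define F where "F = {Q. Q \<subseteq> K \<and> Q \<inter> H = {} \<and> (\<forall>x\<in>Q. \<forall>y\<in>Q. x \<otimes> y \<in> Q)
    \<and> (\<forall>x\<in>Q. \<forall>h\<in>H. x \<otimes> h \<in> Q)}"
  have "\<exists>M\<in>F. \<forall>X\<in>F. M \<subseteq> X \<longrightarrow> X = M"
  proof (rule subset_Zorn')
    fix C assume C: "subset.chain F C"
    have CF: "\<And>Q. Q \<in> C \<Longrightarrow> Q \<in> F" using C by (auto simp: subset.chain_def)
    have "x \<otimes> y \<in> \<Union>C" if xy: "x \<in> \<Union>C" "y \<in> \<Union>C" for x y
    proof -
      obtain A B where AB: "A \<in> C" "B \<in> C" "x \<in> A" "y \<in> B" using xy by blast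
      then have "A \<subseteq> B \<or> B \<subseteq> A" using C by (auto simp: subset_chain_def)
      then obtain D where D: "D \<in> C" "x \<in> D" "y \<in> D" using AB by blast
      then have "x \<otimes> y \<in> D" using CF[OF D(1)] by (simp add: F_def)
      then show ?thesis using D by blast
    qed
    moreover have "\<Union>C \<subseteq> K" "\<Union>C \<inter> H = {}" using CF unfolding F_def by blast+
    moreover have "x \<otimes> h \<in> \<Union>C" if x: "x \<in> \<Union>C" and h: "h \<in> H" for x h
    proof -
      obtain D where D: "D \<in> C" "x \<in> D" using x by blast
      then have "x \<otimes> h \<in> D" using CF[OF D(1)] h by (simp add: F_def)
      then show ?thesis using D by blast
    qed
    ultimately show "\<Union>C \<in> F" unfolding F_def by simp
  qed
  then obtain Q where Q: "Q \<in> F" and max: "\<And>X. X \<in> F \<Longrightarrow> Q \<subseteq> X \<Longrightarrow> X = Q" by blast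
  have QK: "Q \<subseteq> K" and QH: "Q \<inter> H = {}" and QQ: "\<And>x y. x \<in> Q \<Longrightarrow> y \<in> Q \<Longrightarrow> x \<otimes> y \<in> Q"
    and QHr: "\<And>x h. x \<in> Q \<Longrightarrow> h \<in> H \<Longrightarrow> x \<otimes> h \<in> Q" using Q by (auto simp: F_def)
  have QHl: "h \<otimes> x \<in> Q" if xh: "x \<in> Q" "h \<in> H" for x h
  proof -
    obtain k where "k \<in> H" "h \<otimes> x = x \<otimes> h \<otimes> k" using ab[of h x] xh QK HK by blast
    then show ?thesis using QHr xh by simp
  qed
  have Qpow: "x [^] n \<in> Q" if "x \<in> Q" "n > 0" for x and n :: nat
    using that(2)
  proof (induction n)
    case (Suc n)
    then show ?case using that(1) QQ QK by (cases "n = 0") auto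
  qed simp
  \<comment> \<open>By maximality, adjoining \<open>x\<close> to \<open>Q\<close> either adds
    nothing or runs into \<open>H\<close>, and the latter puts a negative power of \<open>x\<close>
    into \<open>Q\<close>.\<close>
  have dich: "x \<in> Q \<or> (\<exists>n>0. inv (x [^] (n::nat)) \<in> Q)" if x: "x \<in> K" "x \<notin> H" for x
  proof (rule ccontr)
    assume con: "\<not> ?thesis"
    \<comment> \<open>The semigroup generated by \<open>Q\<close> and \<open>x\<close> modulo
      \<open>H\<close>. The guard \<open>0 < n\<close> for \<open>r \<in> H\<close> keeps
      \<open>H\<close> itself out of \<open>R\<close>.\<close>
    define R where "R = {x [^] (n::nat) \<otimes> r | n r. r \<in> Q \<or> 0 < n \<and> r \<in> H}"
    have xpow: "x [^] (n::nat) \<in> K" for n by (induction n) (use x in auto)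
    have RK: "R \<subseteq> K" using xpow QK HK by (auto simp: R_def)
    have mult: "\<exists>h\<in>H. (x [^] n \<otimes> r) \<otimes> (x [^] m \<otimes> s) = x [^] (n + m) \<otimes> (r \<otimes> s \<otimes> h)"
      if rs: "r \<in> K" "s \<in> K" for r s and n m :: nat
    proof -
      obtain h where h: "h \<in> H" "r \<otimes> x [^] m = x [^] m \<otimes> r \<otimes> h" using ab[OF rs(1) xpow] by blast
      obtain k where k: "k \<in> H" "h \<otimes> s = s \<otimes> h \<otimes> k" using ab[of h s] rs(2) h HK by blast
      have cc: "r \<in> carrier G" "s \<in> carrier G" "x \<in> carrier G" using rs x by auto
      have "(x [^] n \<otimes> r) \<otimes> (x [^] m \<otimes> s) = x [^] n \<otimes> (r \<otimes> x [^] m) \<otimes> s"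
        using cc by (simp add: m_assoc)
      also have "\<dots> = x [^] n \<otimes> x [^] m \<otimes> r \<otimes> (h \<otimes> s)"
        using cc h by (simp add: m_assoc)
      also have "\<dots> = x [^] (n + m) \<otimes> (r \<otimes> s \<otimes> (h \<otimes> k))"
        using cc h k by (simp add: m_assoc flip: nat_pow_mult)
      finally show ?thesis using h k by blast
    qed
    have "R \<inter> H = {}"
    proof -
      have False if rq: "r \<in> Q \<or> 0 < n \<and> r \<in> H" and w: "x [^] n \<otimes> r \<in> H" for n :: nat and r
      proof -
        have cc: "r \<in> carrier G" "x \<in> carrier G" using rq QK x by auto
        show False
        proof (cases "r \<in> H")
          case True
          then have "n > 0" using rq QH by auto
          have "(x [^] n \<otimes> r) \<otimes> inv r \<in> H" using True w by blast
          then have "x [^] n \<in> H" using cc by (simp add: m_assoc)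
          then show False using isol x \<open>n > 0\<close> by blast
        next
          case False
          then have r: "r \<in> Q" using rq by simp
          have "r \<otimes> inv (x [^] n \<otimes> r) \<in> Q" using QHr r w by blast
          then have inQ: "inv (x [^] n) \<in> Q" using cc by (simp add: inv_mult_group)
          moreover have "n > 0"
          proof (rule ccontr)
            assume "\<not> n > 0"
            then have "\<one> \<in> Q" using inQ by simp
            then show False using QH H.one_closed by (metis disjoint_iff)
          qed
          ultimately show False using con by blast
        qed
      qed
      then show ?thesis unfolding R_def by blast
    qed
    moreover have "a \<otimes> b \<in> R" if abR: "a \<in> R" "b \<in> R" for a b
    proof -
      obtain n :: nat and r where a: "a = x [^] n \<otimes> r" "r \<in> Q \<or> 0 < n \<and> r \<in> H" using abR(1) unfolding R_def by blast
      obtain m :: nat and s where b: "b = x [^] m \<otimes> s" "s \<in> Q \<or> 0 < m \<and> s \<in> H" using abR(2) unfolding R_def by blast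
      obtain h where h: "h \<in> H" "a \<otimes> b = x [^] (n + m) \<otimes> (r \<otimes> s \<otimes> h)"
        using mult[of r s n m] a b QK HK by blast
      have "r \<otimes> s \<otimes> h \<in> Q \<or> 0 < n + m \<and> r \<otimes> s \<otimes> h \<in> H"
        using a(2) b(2) h QQ QHr QHl by auto
      then show ?thesis unfolding h(2) R_def by blast
    qed
    moreover have "a \<otimes> h \<in> R" if aR: "a \<in> R" and h: "h \<in> H" for a h
    proof -
      obtain n :: nat and r where a: "a = x [^] n \<otimes> r" "r \<in> Q \<or> 0 < n \<and> r \<in> H" using aR unfolding R_def by blast
      have "r \<in> carrier G" using a QK by auto
      then have "a \<otimes> h = x [^] n \<otimes> (r \<otimes> h)" using a h x by (simp add: m_assoc)
      then show ?thesis using a h QHr unfolding R_def by blast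
    qed
    ultimately have "R \<in> F" using RK by (auto simp: F_def)
    moreover have "Q \<subseteq> R"
    proof
      fix q assume q: "q \<in> Q"
      then have "q = x [^] (0::nat) \<otimes> q" using QK by auto
      then show "q \<in> R" using q unfolding R_def by blast
    qed
    ultimately have "R = Q" using max by blast
    moreover have "x \<in> R"
    proof -
      have "x = x [^] (1::nat) \<otimes> \<one>" using x by simp
      then show ?thesis unfolding R_def using H.one_closed zero_less_one by blast
    qed
    ultimately show False using con by simp
  qed
  \<comment> \<open>If neither \<open>x\<close> nor its inverse were in \<open>Q\<close>, then
    \<open>Q\<close> would contain both a negative power \<open>- n\<close> and a positive power
    \<open>m\<close> of \<open>x\<close>; raising them to the powers \<open>m\<close> and
    \<open>n\<close> and multiplying gives \<open>\<one>\<close>.\<close>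
  have tot: "x \<in> H \<or> x \<in> Q \<or> inv x \<in> Q" if x: "x \<in> K" for x
  proof (rule ccontr)
    assume con: "\<not> ?thesis"
    have xc: "x \<in> carrier G" using x by simp
    obtain n :: nat where n: "n > 0" "inv (x [^] n) \<in> Q" using dich[of x] x con by auto
    have "inv x \<notin> H" using con H.m_inv_closed[of "inv x"] xc by auto
    then obtain m :: nat where m: "m > 0" "inv (inv x [^] m) \<in> Q" using dich[of "inv x"] x con by auto
    have "inv (inv x [^] m) = x [^] m" using xc by (simp add: nat_pow_inv)
    then have "(x [^] m) [^] n \<in> Q" using Qpow m n by auto
    moreover have "inv (x [^] n) [^] m \<in> Q" using Qpow m n by auto
    ultimately have "(x [^] m) [^] n \<otimes> inv (x [^] n) [^] m \<in> Q" using QQ by blast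
    also have "(x [^] m) [^] n \<otimes> inv (x [^] n) [^] m = \<one>"
      using xc by (simp add: nat_pow_inv nat_pow_pow mult.commute)
    finally show False using QH H.one_closed by (metis disjoint_iff)
  qed
  show ?thesis using QK QH QQ QHr QHl tot by (intro exI[of _ Q]) simp
qed

text \<open>A lexicographic order: the sign of an element is read in the layer where it is
  nontrivial. In a product the factor from the lower layer is absorbed by the stability of the
  higher cone, on either side.\<close>

lemma torsion_free_nilpotent_positive_cone:
  assumes "torsion_free_group G" "nilpotent_group G"
  obtains P where "P \<subseteq> carrier G" "\<one> \<notin> P" "\<And>x y. x \<in> P \<Longrightarrow> y \<in> P \<Longrightarrow> x \<otimes> y \<in> P"
    "\<And>x. x \<in> carrier G \<Longrightarrow> x = \<one> \<or> x \<in> P \<or> inv x \<in> P"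
proof -
  obtain c where c: "upper_central c = carrier G" using nilpotent_imp_upper_central assms by blast
  define good where "good i Q \<longleftrightarrow> Q \<subseteq> upper_central (Suc i) \<and> Q \<inter> upper_central i = {}
    \<and> (\<forall>x\<in>Q. \<forall>y\<in>Q. x \<otimes> y \<in> Q) \<and> (\<forall>x\<in>Q. \<forall>h\<in>upper_central i. x \<otimes> h \<in> Q \<and> h \<otimes> x \<in> Q)
    \<and> (\<forall>x\<in>upper_central (Suc i). x \<in> upper_central i \<or> x \<in> Q \<or> inv x \<in> Q)" for i Q
  have "\<exists>Q. good i Q" for i
  proof -
    have "\<exists>h\<in>upper_central i. x \<otimes> y = y \<otimes> x \<otimes> h"
      if xy: "x \<in> upper_central (Suc i)" "y \<in> upper_central (Suc i)" for x y
    proof -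
      have cc: "x \<in> carrier G" "y \<in> carrier G" using xy upper_central_carrier by blast+
      have "inv x \<otimes> inv y \<otimes> inv (inv x) \<otimes> inv (inv y) \<in> upper_central i"
        using upper_central_commutator[OF subgroup.m_inv_closed[OF upper_central_subgroup xy(1)]] cc by blast
      moreover have "x \<otimes> y = y \<otimes> x \<otimes> (inv x \<otimes> inv y \<otimes> inv (inv x) \<otimes> inv (inv y))"
        using cc by (simp add: m_assoc)
      ultimately show ?thesis by (rule bexI[rotated])
    qed
    then show ?thesis unfolding good_def
      by (rule torsion_free_abelian_layer_cone[OF upper_central_subgroup upper_central_subgroup])
        (use upper_central_isolated[OF assms(1)] in \<open>blast intro: upper_central_Suc[THEN subsetD]\<close>)+
  qed
  then obtain Q where Q: "\<And>i. good i (Q i)" by metis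
  show ?thesis
  proof (rule that[of "\<Union>i. Q i"])
    show "(\<Union>i. Q i) \<subseteq> carrier G" using Q upper_central_carrier unfolding good_def by blast
    show "\<one> \<notin> (\<Union>i. Q i)"
      using Q subgroup.one_closed[OF upper_central_subgroup] unfolding good_def by blast
    have below: "x \<in> upper_central j" if "x \<in> Q i" "i < j" for x i j
      using that Q[of i] upper_central_mono[of "Suc i" j] unfolding good_def by auto
    show "x \<otimes> y \<in> (\<Union>i. Q i)" if "x \<in> (\<Union>i. Q i)" "y \<in> (\<Union>i. Q i)" for x y
    proof -
      obtain i j where ij: "x \<in> Q i" "y \<in> Q j" using \<open>x \<in> (\<Union>i. Q i)\<close> \<open>y \<in> (\<Union>i. Q i)\<close> by blast
      consider "i < j" | "i = j" | "j < i" by linarith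
      then have "x \<otimes> y \<in> Q i \<or> x \<otimes> y \<in> Q j"
      proof cases
        case 1 then show ?thesis using Q[of j] ij below[OF ij(1) 1] unfolding good_def by blast
      next
        case 2 then show ?thesis using Q[of j] ij unfolding good_def by blast
      next
        case 3 then show ?thesis using Q[of i] ij below[OF ij(2) 3] unfolding good_def by blast
      qed
      then show ?thesis by blast
    qed
    have "x \<in> upper_central j \<Longrightarrow> x = \<one> \<or> x \<in> (\<Union>i. Q i) \<or> inv x \<in> (\<Union>i. Q i)" for x j
    proof (induction j)
      case (Suc j)
      then show ?case using Q[of j] unfolding good_def by blast
    qed simp
    then show "x = \<one> \<or> x \<in> (\<Union>i. Q i) \<or> inv x \<in> (\<Union>i. Q i)" if "x \<in> carrier G" for x
      using that c by blast
  qed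
qed

end

section \<open>Polynomial growth of nilpotent groups\<close>

context group
begin

text \<open>Exactly \<open>n\<close> factors are taken. When \<open>\<one> \<in> U\<close> these
  sets increase and are the balls of the word metric.\<close>

primrec words :: "'a set \<Rightarrow> nat \<Rightarrow> 'a set" where
  "words U 0 = {\<one>}"
| "words U (Suc n) = (\<lambda>(u, w). u \<otimes> w) ` (U \<times> words U n)"

lemma words_carrier: "U \<subseteq> carrier G \<Longrightarrow> words U n \<subseteq> carrier G"
  by (induction n) auto

lemma finite_words: "finite U \<Longrightarrow> finite (words U n)"
  by (induction n) auto

lemma words_mult:
  assumes "U \<subseteq> carrier G" "y \<in> words U n"
  shows "x \<in> words U m \<Longrightarrow> x \<otimes> y \<in> words U (m + n)"
proof (induction m arbitrary: x)
  case 0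
  have "y \<in> carrier G" using assms words_carrier by blast
  then show ?case using 0 assms by simp
next
  case (Suc m)
  then obtain u w where uw: "u \<in> U" "w \<in> words U m" "x = u \<otimes> w" by auto
  have "x \<otimes> y = u \<otimes> (w \<otimes> y)"
    using uw assms words_carrier[OF assms(1)] by (subst uw, intro m_assoc) auto
  then show ?case using uw(1) Suc.IH[OF uw(2)] by (auto intro!: image_eqI[of _ _ "(u, w \<otimes> y)"])
qed

lemma words_mono_set:
  assumes "U \<subseteq> V" shows "words U n \<subseteq> words V n"
  using assms by (induction n) auto

lemma words_mono:
  assumes U: "U \<subseteq> carrier G" "\<one> \<in> U" and le: "m \<le> n"
  shows "words U m \<subseteq> words U n"
proof (rule lift_Suc_mono_le[OF _ le])
  fix n
  show "words U n \<subseteq> words U (Suc n)"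
  proof
    fix w assume w: "w \<in> words U n"
    have "w \<in> carrier G" using w words_carrier[OF U(1)] by blast
    then show "w \<in> words U (Suc n)"
      using U w by (auto intro!: image_eqI[of _ _ "(\<one>, w)"])
  qed
qed

lemma one_in_words: "U \<subseteq> carrier G \<Longrightarrow> \<one> \<in> U \<Longrightarrow> \<one> \<in> words U n"
  using words_mono[of U 0 n] by simp

lemma in_words_1: "U \<subseteq> carrier G \<Longrightarrow> u \<in> U \<Longrightarrow> u \<in> words U 1"
  by (auto intro!: image_eqI[of _ _ "(u, \<one>)"])

text \<open>Testing all finite subsets, with constants depending on the subset, gives a meaning to
  growth for subgroups not known to be finitely generated.\<close>

definition poly_growth :: "'a set \<Rightarrow> bool" where
  "poly_growth H \<longleftrightarrow>
     (\<forall>U. finite U \<longrightarrow> U \<subseteq> H \<longrightarrow> (\<exists>C D. \<forall>n. card (words U n) \<le> C * (n + 1) ^ D))"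

text \<open>
  With \<open>\<theta> v = t\<inverse> v t\<close> and \<open>d = v\<inverse> \<theta> v\<close> one has \<open>\<theta>\<^sup>b v = v \<cdot> d \<cdot> \<theta> d \<cdots> \<theta>\<^sup>b\<^sup>-\<^sup>1 d\<close>, and \<open>d\<close> lies one
  step lower in the central series.
\<close>
lemma conj_nat_pow_words:
  assumes K: "subgroup K G" and t: "t \<in> carrier G"
    and tK: "\<And>k. k \<in> K \<Longrightarrow> inv t \<otimes> k \<otimes> t \<in> K"
  shows "v \<in> K \<Longrightarrow> v \<in> upper_central j \<Longrightarrow> \<exists>U D. finite U \<and> U \<subseteq> K \<and> \<one> \<in> U
    \<and> (\<forall>b::nat. inv (t [^] b) \<otimes> v \<otimes> t [^] b \<in> words U ((b + 1) ^ D))"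
proof (induction j arbitrary: v)
  case 0
  have "\<one> \<in> words {\<one>} n" for n by (rule one_in_words) auto
  then show ?case using 0 t subgroup.one_closed[OF K]
    by (intro exI[of _ "{\<one>}"]) (auto simp: m_assoc)
next
  case (Suc j)
  have Kc: "K \<subseteq> carrier G" using K by (rule subgroup.subset)
  have vc: "v \<in> carrier G" using Suc.prems(1) Kc by blast
  define d where "d = inv v \<otimes> (inv t \<otimes> v \<otimes> t)"
  have dK: "d \<in> K" unfolding d_def
    by (intro subgroup.m_closed[OF K] subgroup.m_inv_closed[OF K] tK Suc.prems(1))
  have dj: "d \<in> upper_central j"
    using upper_central_commutator[OF subgroup.m_inv_closed[OF upper_central_subgroup Suc.prems(2)], of "inv t"]
      vc t by (simp add: d_def m_assoc)
  obtain U D where U: "finite U" "U \<subseteq> K" "\<one> \<in> U"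
    and w: "\<And>b::nat. inv (t [^] b) \<otimes> d \<otimes> t [^] b \<in> words U ((b + 1) ^ D)"
    using Suc.IH[OF dK dj] by blast
  have dc: "d \<in> carrier G" using dK Kc by blast
  let ?V = "insert v U"
  have V: "?V \<subseteq> carrier G" "\<one> \<in> ?V" using U Kc vc by auto
  \<comment> \<open>One letter \<open>v\<close>, then \<open>b\<close> conjugates of
    \<open>d\<close>, each a word of length at most \<open>(b + 1) ^ D\<close>.\<close>
  have main: "inv (t [^] b) \<otimes> v \<otimes> t [^] b \<in> words ?V (1 + b * (b + 1) ^ D)" for b :: nat
  proof (induction b)
    case 0
    then show ?case using vc in_words_1[OF V(1), of v] by simp
  next
    case (Suc b)
    have "inv (t [^] b) \<otimes> d \<otimes> t [^] b \<in> words ?V ((b + 1) ^ D)"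
      using w words_mono_set[of U ?V] by blast
    from words_mult[OF V(1) this Suc]
    have 1: "(inv (t [^] b) \<otimes> v \<otimes> t [^] b) \<otimes> (inv (t [^] b) \<otimes> d \<otimes> t [^] b)
       \<in> words ?V (1 + b * (b + 1) ^ D + (b + 1) ^ D)" .
    have 2: "(inv (t [^] b) \<otimes> v \<otimes> t [^] b) \<otimes> (inv (t [^] b) \<otimes> d \<otimes> t [^] b)
       = inv (t [^] Suc b) \<otimes> v \<otimes> t [^] Suc b"
    proof -
      have "t [^] Suc b = t \<otimes> t [^] b" using t by (rule nat_pow_Suc2)
      then show ?thesis using t vc dc by (simp add: d_def m_assoc inv_mult_group del: nat_pow_Suc)
    qed
    have 3: "1 + b * (b + 1) ^ D + (b + 1) ^ D \<le> 1 + Suc b * (Suc b + 1) ^ D"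
    proof -
      have "b * (b + 1) ^ D + (b + 1) ^ D = Suc b * (b + 1) ^ D" by simp
      also have "\<dots> \<le> Suc b * (Suc b + 1) ^ D" by (intro mult_le_mono power_mono) auto
      finally show ?thesis by simp
    qed
    show ?case by (rule subsetD[OF words_mono[OF V 3] 1[unfolded 2]])
  qed
  have "inv (t [^] b) \<otimes> v \<otimes> t [^] b \<in> words ?V ((b + 1) ^ Suc D)" for b :: nat
  proof -
    have "1 \<le> (b + 1) ^ D" by simp
    then have "1 + b * (b + 1) ^ D \<le> (b + 1) ^ Suc D" by simp
    then show ?thesis using main[of b] words_mono[OF V] by blast
  qed
  then show ?case using U Suc.prems(1) by (intro exI[of _ ?V] exI[of _ "Suc D"]) auto
qed

text \<open>Negative exponents are natural powers of \<open>inv t\<close>. A finite \<open>V\<close>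
  is handled by uniting the alphabets and adding the degrees.\<close>

lemma conj_int_pow_words:
  assumes K: "subgroup K G" and c: "upper_central c = carrier G" and t: "t \<in> carrier G"
    and tK: "\<And>k. k \<in> K \<Longrightarrow> inv t \<otimes> k \<otimes> t \<in> K" "\<And>k. k \<in> K \<Longrightarrow> t \<otimes> k \<otimes> inv t \<in> K"
    and V: "finite V" "V \<subseteq> K"
  shows "\<exists>U D. finite U \<and> U \<subseteq> K \<and> \<one> \<in> U
    \<and> (\<forall>v\<in>V. \<forall>e::int. inv (t [^] e) \<otimes> v \<otimes> t [^] e \<in> words U ((nat \<bar>e\<bar> + 1) ^ D))"
  using V
proof (induction V rule: finite_induct)
  case empty
  then show ?case using subgroup.one_closed[OF K] by (intro exI[of _ "{\<one>}"]) auto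
next
  case (insert v V)
  have Kc: "K \<subseteq> carrier G" using K by (rule subgroup.subset)
  have v: "v \<in> K" "v \<in> upper_central c" using insert.prems c Kc by auto
  obtain U D where U: "finite U" "U \<subseteq> K" "\<one> \<in> U"
    and Uw: "\<And>w e. w \<in> V \<Longrightarrow> inv (t [^] (e::int)) \<otimes> w \<otimes> t [^] e \<in> words U ((nat \<bar>e\<bar> + 1) ^ D)"
    using insert by blast
  obtain U1 D1 where U1: "finite U1" "U1 \<subseteq> K" "\<one> \<in> U1"
    and U1w: "\<And>b. inv (t [^] (b::nat)) \<otimes> v \<otimes> t [^] b \<in> words U1 ((b + 1) ^ D1)"
    using conj_nat_pow_words[OF K t tK(1) v] by blast
  have "\<And>k. k \<in> K \<Longrightarrow> inv (inv t) \<otimes> k \<otimes> inv t \<in> K" using tK(2) t by simp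
  from conj_nat_pow_words[OF K inv_closed[OF t] this v]
  obtain U2 D2 where U2: "finite U2" "U2 \<subseteq> K" "\<one> \<in> U2"
    and U2w: "\<And>b. inv (inv t [^] (b::nat)) \<otimes> v \<otimes> inv t [^] b \<in> words U2 ((b + 1) ^ D2)"
    by blast
  let ?U = "U \<union> U1 \<union> U2" and ?D = "D + D1 + D2"
  have UK: "?U \<subseteq> K" "?U \<subseteq> carrier G" "\<one> \<in> ?U" using U U1 U2 Kc by auto
  have lift: "x \<in> words ?U ((b + 1) ^ ?D)"
    if x: "x \<in> words W ((b + 1) ^ d)" and W: "W \<subseteq> ?U" "d \<le> ?D" for x W d b
  proof -
    have "(b + 1) ^ d \<le> (b + 1) ^ ?D" using W(2) by (intro power_increasing) auto
    then show ?thesis using words_mono[OF UK(2,3)] words_mono_set[OF W(1)] x by blast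
  qed
  have "inv (t [^] e) \<otimes> w \<otimes> t [^] e \<in> words ?U ((nat \<bar>e\<bar> + 1) ^ ?D)"
    if w: "w \<in> insert v V" for w and e :: int
  proof (cases "w = v")
    case False
    then show ?thesis using w by (intro lift[OF Uw]) auto
  next
    case True
    show ?thesis
    proof (cases e)
      case (nonneg n)
      show ?thesis using lift[OF U1w, of n] by (simp add: True nonneg int_pow_int ac_simps)
    next
      case (neg n)
      have te: "t [^] e = inv t [^] Suc n"
        by (simp only: neg int_pow_neg[OF t] int_pow_int nat_pow_inv[OF t])
      have ae: "nat \<bar>e\<bar> = Suc n" by (simp add: neg)
      show ?thesis unfolding te ae True by (rule lift[OF U2w]) auto
    qed
  qed
  then show ?case using U U1 U2 by (intro exI[of _ ?U] exI[of _ ?D]) auto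
qed

text \<open>All powers of \<open>t\<close> are collected on the left. The exponent grows linearly
  and each letter from \<open>K\<close> is replaced by a conjugate of polynomial length, so a word
  is encoded by an exponent and a word in \<open>K\<close> of polynomial length.\<close>

lemma poly_growth_cyclic_extension:
  assumes K: "subgroup K G" and c: "upper_central c = carrier G" and t: "t \<in> carrier G"
    and tK: "\<And>k. k \<in> K \<Longrightarrow> inv t \<otimes> k \<otimes> t \<in> K" "\<And>k. k \<in> K \<Longrightarrow> t \<otimes> k \<otimes> inv t \<in> K"
    and pg: "poly_growth K"
  shows "poly_growth {t [^] (e::int) \<otimes> k | e k. k \<in> K}"
  unfolding poly_growth_def
proof (intro allI impI)
  fix U assume U: "finite U" "U \<subseteq> {t [^] (e::int) \<otimes> k | e k. k \<in> K}"
  have Kc: "K \<subseteq> carrier G" using K by (rule subgroup.subset)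
  have "\<forall>u\<in>U. \<exists>e k. k \<in> K \<and> u = t [^] (e::int) \<otimes> k" using U by blast
  then obtain ex kk where ek: "\<And>u. u \<in> U \<Longrightarrow> kk u \<in> K \<and> u = t [^] (ex u :: int) \<otimes> kk u" by metis
  obtain W D where W: "finite W" "W \<subseteq> K" "\<one> \<in> W"
    and Ww: "\<And>v e. v \<in> kk ` U \<Longrightarrow> inv (t [^] (e::int)) \<otimes> v \<otimes> t [^] e \<in> words W ((nat \<bar>e\<bar> + 1) ^ D)"
    using conj_int_pow_words[OF K c t tK, of "kk ` U"] U(1) ek by blast
  have Wc: "W \<subseteq> carrier G" using W Kc by blast
  obtain E where E: "\<And>u. u \<in> U \<Longrightarrow> nat \<bar>ex u\<bar> \<le> E"
    using finite_imageI[OF U(1), of "\<lambda>u. nat \<bar>ex u\<bar>"] unfolding finite_nat_set_iff_bounded_le by blast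
  obtain C D' where CD: "\<And>n. card (words W n) \<le> C * (n + 1) ^ D'"
    using pg W unfolding poly_growth_def by blast
  \<comment> \<open>Bounds the \<open>K\<close>-part of a word of length \<open>n\<close>:
    \<open>n\<close> letters, each conjugated by a power of \<open>t\<close> with exponent at most
    \<open>n * E\<close> in absolute value.\<close>
  define N where "N n = n * (n * E + 1) ^ D" for n
  have form: "\<exists>e k. x = t [^] (e::int) \<otimes> k \<and> nat \<bar>e\<bar> \<le> n * E \<and> k \<in> words W (N n)"
    if "x \<in> words U n" for x n
    using that
  proof (induction n arbitrary: x)
    case 0
    then show ?case by (intro exI[of _ 0] exI[of _ \<one>]) (simp add: N_def)
  next
    case (Suc n)
    then obtain u w where uw: "u \<in> U" "w \<in> words U n" "x = u \<otimes> w" by auto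
    obtain e k where k: "w = t [^] (e::int) \<otimes> k" "nat \<bar>e\<bar> \<le> n * E" "k \<in> words W (N n)"
      using Suc.IH uw by blast
    have kc: "k \<in> carrier G" "kk u \<in> carrier G" using k words_carrier[OF Wc] ek uw Kc by auto
    let ?v = "inv (t [^] e) \<otimes> kk u \<otimes> t [^] e"
    have "x = t [^] (ex u) \<otimes> kk u \<otimes> (t [^] e \<otimes> k)" using uw k ek by simp
    also have "\<dots> = t [^] (ex u) \<otimes> t [^] e \<otimes> (?v \<otimes> k)" using t kc by (simp add: m_assoc)
    also have "\<dots> = t [^] (ex u + e) \<otimes> (?v \<otimes> k)" using t by (simp add: int_pow_mult)
    finally have x: "x = t [^] (ex u + e) \<otimes> (?v \<otimes> k)" .
    have "?v \<in> words W ((nat \<bar>e\<bar> + 1) ^ D)" using Ww uw by blast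
    then have "?v \<otimes> k \<in> words W ((nat \<bar>e\<bar> + 1) ^ D + N n)" by (rule words_mult[OF Wc k(3)])
    moreover have "(nat \<bar>e\<bar> + 1) ^ D + N n \<le> N (Suc n)"
    proof -
      have "(nat \<bar>e\<bar> + 1) ^ D \<le> (Suc n * E + 1) ^ D" using k(2) by (intro power_mono) auto
      moreover have "n * (n * E + 1) ^ D \<le> n * (Suc n * E + 1) ^ D"
        by (intro mult_le_mono power_mono) auto
      ultimately have "(nat \<bar>e\<bar> + 1) ^ D + n * (n * E + 1) ^ D
          \<le> (Suc n * E + 1) ^ D + n * (Suc n * E + 1) ^ D" by (rule add_mono)
      also have "\<dots> = Suc n * (Suc n * E + 1) ^ D" by (simp only: mult_Suc)
      finally show ?thesis unfolding N_def .
    qed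
    ultimately have "?v \<otimes> k \<in> words W (N (Suc n))" using words_mono[OF Wc W(3)] by blast
    moreover have "nat \<bar>ex u + e\<bar> \<le> Suc n * E" using E[OF uw(1)] k(2) by simp
    ultimately show ?case using x by blast
  qed
  \<comment> \<open>The exponents number \<open>2 * (n * E) + 1\<close>, which is linear in
    \<open>n\<close>; the \<open>K\<close>-parts contribute \<open>N n\<close>, of degree
    \<open>D + 1\<close>, to the power \<open>D'\<close>.\<close>
  have "card (words U n) \<le> (2 * E + 1) * C * (E + 1) ^ (D * D') * (n + 1) ^ (1 + (D + 1) * D')" for n
  proof -
    let ?S = "{- int (n * E)..int (n * E)} \<times> words W (N n)"
    have fin: "finite ?S" using finite_words[OF W(1)] by blast
    have "words U n \<subseteq> (\<lambda>(e, k). t [^] e \<otimes> k) ` ?S"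
    proof
      fix x assume "x \<in> words U n"
      then obtain e k where ek': "x = t [^] (e::int) \<otimes> k" "nat \<bar>e\<bar> \<le> n * E" "k \<in> words W (N n)"
        using form by blast
      then have "\<bar>e\<bar> \<le> int (n * E)" by linarith
      then have "e \<in> {- int (n * E)..int (n * E)}" unfolding atLeastAtMost_iff by linarith
      with ek' show "x \<in> (\<lambda>(e, k). t [^] e \<otimes> k) ` ?S" by (intro image_eqI[of _ _ "(e, k)"]) auto
    qed
    then have "card (words U n) \<le> card ?S"
      using fin by (meson card_image_le card_mono finite_imageI le_trans)
    also have "\<dots> = (2 * (n * E) + 1) * card (words W (N n))"
      by (simp add: card_cartesian_product nat_add_distrib nat_mult_distrib)
    also have "\<dots> \<le> ((2 * E + 1) * (n + 1)) * (C * ((E + 1) ^ D * (n + 1) ^ (D + 1)) ^ D')"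
    proof (intro mult_le_mono order_trans[OF CD] le_refl power_mono)
      have "n * E + 1 \<le> (E + 1) * (n + 1)" by simp
      then have "(n * E + 1) ^ D \<le> ((E + 1) * (n + 1)) ^ D" by (intro power_mono) auto
      then have "(n + 1) * (n * E + 1) ^ D \<le> (n + 1) * ((E + 1) ^ D * (n + 1) ^ D)"
        by (simp only: power_mult_distrib mult_le_mono2)
      moreover have "N n + 1 \<le> (n + 1) * (n * E + 1) ^ D" by (simp add: N_def)
      ultimately have "N n + 1 \<le> (n + 1) * ((E + 1) ^ D * (n + 1) ^ D)" by linarith
      also have "\<dots> = (E + 1) ^ D * (n + 1) ^ (D + 1)"
        by (simp only: power_add power_one_right mult_ac)
      finally show "N n + 1 \<le> (E + 1) ^ D * (n + 1) ^ (D + 1)" .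
    qed auto
    also have "\<dots> = (2 * E + 1) * C * (E + 1) ^ (D * D') * (n + 1) ^ (1 + (D + 1) * D')"
      unfolding power_add[of "n + 1" 1] by (simp only: power_mult_distrib power_mult[symmetric] power_one_right mult_ac)
    finally show ?thesis .
  qed
  then show "\<exists>C D. \<forall>n. card (words U n) \<le> C * (n + 1) ^ D" by blast
qed

text \<open>Growth is tested on finite subsets, so it suffices to adjoin finitely many elements of
  the layer one at a time. Every subgroup between two consecutive terms is normal, hence each
  adjunction is a cyclic extension.\<close>

lemma poly_growth_upper_central:
  assumes c: "upper_central c = carrier G"
  shows "poly_growth (upper_central i)"
proof (induction i)
  case 0
  have "card (words U n) \<le> 1 * (n + 1) ^ 0" if "U \<subseteq> {\<one>}" for U n
  proof -
    have "words U n \<subseteq> words {\<one>} n" by (rule words_mono_set[OF that])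
    also have "words {\<one>} n = {\<one>}" by (induction n) auto
    finally show ?thesis using card_mono[of "{\<one>}"] by auto
  qed
  then show ?case unfolding poly_growth_def upper_central.simps by blast
next
  case (Suc i)
  let ?A = "upper_central i" and ?B = "upper_central (Suc i)"
  \<comment> \<open>A conjugate of \<open>k\<close> is \<open>k\<close> multiplied by the inverse of
    a commutator, which already lies in the lower term.\<close>
  have conj: "g \<otimes> k \<otimes> inv g \<in> K" if K: "subgroup K G" "?A \<subseteq> K" "K \<subseteq> ?B" and k: "k \<in> K" and g: "g \<in> carrier G"
    for K k g
  proof -
    have kc: "k \<in> carrier G" using K k subgroup.subset by blast
    have "k \<in> ?B" using k K by blast
    from upper_central_commutator[OF this g] have "k \<otimes> g \<otimes> inv k \<otimes> inv g \<in> K" using K by blast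
    then have "inv (k \<otimes> g \<otimes> inv k \<otimes> inv g) \<otimes> k \<in> K"
      using K k by (simp add: subgroup.m_closed subgroup.m_inv_closed)
    then show ?thesis using kc g by (simp add: m_assoc inv_mult_group)
  qed
  have step: "\<exists>K. subgroup K G \<and> ?A \<subseteq> K \<and> K \<subseteq> ?B \<and> T \<subseteq> K \<and> poly_growth K"
    if "finite T" "T \<subseteq> ?B" for T
    using that
  proof (induction T rule: finite_induct)
    case empty
    then show ?case using Suc upper_central_Suc upper_central_subgroup by blast
  next
    case (insert t T)
    then obtain K where K: "subgroup K G" "?A \<subseteq> K" "K \<subseteq> ?B" "T \<subseteq> K" "poly_growth K" by blast
    have tc: "t \<in> carrier G" using insert.prems upper_central_carrier by blast
    let ?H = "{t [^] (e::int) \<otimes> k | e k. k \<in> K}"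
    have Kn: "K \<lhd> G" unfolding normal_inv_iff using K conj by blast
    have "?H = generate G {t} <#> K"
      unfolding generate_pow[OF tc] set_mult_def by blast
    moreover have "subgroup (generate G {t}) G" using tc by (intro generate_is_subgroup) auto
    ultimately have Hs: "subgroup ?H G" using mult_norm_subgroup[OF Kn] commut_normal[OF _ Kn] by metis
    have "poly_growth ?H"
    proof (rule poly_growth_cyclic_extension[OF K(1) c tc _ _ K(5)])
      show "inv t \<otimes> k \<otimes> t \<in> K" if "k \<in> K" for k
        using conj[OF K(1-3) that, of "inv t"] tc by simp
      show "t \<otimes> k \<otimes> inv t \<in> K" if "k \<in> K" for k
        using conj[OF K(1-3) that] tc by simp
    qed
    moreover have "?H \<subseteq> ?B"
      using K insert.prems upper_central_subgroup[of "Suc i"]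
      by (auto intro!: subgroup.m_closed subgroup_int_pow_closed simp del: upper_central.simps)
    moreover have KH: "K \<subseteq> ?H"
    proof
      fix k assume k: "k \<in> K"
      then have "k = t [^] (0::int) \<otimes> k" using K(1) subgroup.mem_carrier by fastforce
      then show "k \<in> ?H" using k by blast
    qed
    moreover have "t \<in> ?H"
    proof -
      have "t = t [^] (1::int) \<otimes> \<one>" using tc by simp
      then show ?thesis using subgroup.one_closed[OF K(1)] by blast
    qed
    ultimately show ?case using Hs K by (intro exI[of _ ?H]) auto
  qed
  show ?case unfolding poly_growth_def
  proof (intro allI impI)
    fix U assume U: "finite U" "U \<subseteq> ?B"
    from step[OF U] obtain K where K: "U \<subseteq> K" "poly_growth K" by (elim exE conjE)
    show "\<exists>C D. \<forall>n. card (words U n) \<le> C * (n + 1) ^ D"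
      by (rule K(2)[unfolded poly_growth_def, rule_format, OF U(1) K(1)])
  qed
qed

end

section \<open>Weights that vary slowly under translations\<close>

lemma ratio_power_near_1:
  fixes k p :: nat and \<epsilon> :: real
  assumes "\<epsilon> > 0"
  obtains N :: nat where "\<And>n m :: nat. N \<le> n \<Longrightarrow> n \<le> m + k \<Longrightarrow> m \<le> n + k \<Longrightarrow>
    \<bar>(((1 + real n) / (1 + real m)) ^ p)\<^sup>2 - 1\<bar> < \<epsilon>"
proof -
  have "isCont (\<lambda>y::real. (y ^ p)\<^sup>2) 1" by (intro continuous_intros)
  then obtain d where d: "d > 0" "\<And>y::real. \<bar>y - 1\<bar> < d \<Longrightarrow> \<bar>(y ^ p)\<^sup>2 - 1\<bar> < \<epsilon>"
    using assms unfolding continuous_at_eps_delta dist_real_def by fastforce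
  \<comment> \<open>From \<open>m \<ge> n - k\<close> this forces \<open>m > k / d\<close>, so a
    difference of at most \<open>k\<close> is small relative to \<open>1 + m\<close>.\<close>
  obtain N :: nat where N: "real k + real k / d < real N" using reals_Archimedean2 by blast
  show ?thesis
  proof (rule that[of N], rule d(2))
    fix n m :: nat assume nm: "N \<le> n" "n \<le> m + k" "m \<le> n + k"
    have "real k / d < 1 + real m" using N nm by linarith
    then have "real k < d * (1 + real m)" using d(1) by (simp add: field_simps)
    moreover have "\<bar>real n - real m\<bar> \<le> real k" using nm by linarith
    ultimately have "\<bar>real n - real m\<bar> / (1 + real m) < d" by (simp add: divide_less_eq)
    moreover have "(1 + real n) / (1 + real m) - 1 = (real n - real m) / (1 + real m)"
      by (simp add: field_simps)
    ultimately show "\<bar>(1 + real n) / (1 + real m) - 1\<bar> < d" by (simp add: abs_divide)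
  qed
qed

context group
begin

lemma ex_word:
  assumes A: "A \<subseteq> carrier G" and x: "x \<in> generate G A"
  shows "\<exists>n. x \<in> words (insert \<one> (A \<union> m_inv G ` A)) n"
  using x
proof induction
  case one
  then show ?case by (intro exI[of _ 0]) simp
next
  case (incl h)
  then show ?case using A by (intro exI[of _ 1] in_words_1) auto
next
  case (inv h)
  then show ?case using A by (intro exI[of _ 1] in_words_1) auto
next
  case (eng h1 h2)
  have "insert \<one> (A \<union> m_inv G ` A) \<subseteq> carrier G" using A by auto
  then show ?case using eng words_mult by blast
qed

lemma nilpotent_summable_weight:
  assumes fg: "finitely_generated_group G" and nil: "nilpotent_group G"
  obtains l :: "'a \<Rightarrow> real" where "\<And>x. x \<in> carrier G \<Longrightarrow> 0 < l x" "(l has_sum 1) (carrier G)"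
    "\<And>g \<epsilon>. g \<in> carrier G \<Longrightarrow> \<epsilon> > 0 \<Longrightarrow> finite {x \<in> carrier G. \<epsilon> \<le> \<bar>(l (g \<otimes> x) / l x)\<^sup>2 - 1\<bar>}"
proof -
  obtain A where A: "finite A" "A \<subseteq> carrier G" "generate G A = carrier G"
    using fg by (auto simp: finitely_generated_group_def)
  obtain c where c: "upper_central c = carrier G" using nilpotent_imp_upper_central[OF nil] by blast
  define U where "U = insert \<one> (A \<union> m_inv G ` A)"
  have U: "U \<subseteq> carrier G" "finite U" "\<one> \<in> U" using A by (auto simp: U_def)
  obtain C D where CD: "\<And>n. card (words U n) \<le> C * (n + 1) ^ D"
    using poly_growth_upper_central[OF c, of c] U unfolding poly_growth_def c by blast
  define wl where "wl x = (LEAST n. x \<in> words U n)" for x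
  have wl_mem: "x \<in> words U (wl x)" if "x \<in> carrier G" for x
    unfolding wl_def by (rule LeastI_ex) (use ex_word[OF A(2)] A(3) that in \<open>simp add: U_def\<close>)
  have wl_le: "wl x \<le> n" if "x \<in> words U n" for x n
    unfolding wl_def by (rule Least_le[of "\<lambda>n. x \<in> words U n", OF that])
  have wl_mult: "wl (x \<otimes> y) \<le> wl x + wl y" if "x \<in> carrier G" "y \<in> carrier G" for x y
    by (rule wl_le[OF words_mult[OF U(1) wl_mem[OF that(2)] wl_mem[OF that(1)]]])
  have ball: "finite {x \<in> carrier G. wl x \<le> N}" for N
  proof (rule finite_subset)
    show "{x \<in> carrier G. wl x \<le> N} \<subseteq> words U N"
      using wl_mem words_mono[OF U(1,3)] by blast
  qed (rule finite_words[OF U(2)])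
  \<comment> \<open>The part \<open>D\<close> of the exponent cancels the number of elements of a
    given length; the remaining 2 leaves the convergent series of inverse squares.\<close>
  define m where "m x = 1 / (1 + real (wl x)) ^ (D + 2)" for x
  have m_pos: "0 < m x" for x by (simp add: m_def)
  have sq: "summable (\<lambda>n. 1 / (1 + real n)\<^sup>2)"
    using inverse_power_summable[of 2, where 'a = real] summable_Suc_iff[of "\<lambda>n. inverse (real n ^ 2)"]
    by (simp add: inverse_eq_divide add.commute)
  have "m summable_on carrier G"
  proof (rule nonneg_bdd_above_summable_on)
    show "bdd_above (sum m ` {F. F \<subseteq> carrier G \<and> finite F})"
    proof (rule bdd_aboveI2)
      fix F assume "F \<in> {F. F \<subseteq> carrier G \<and> finite F}"
      then have F: "F \<subseteq> carrier G" "finite F" by auto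
      obtain N where N: "\<And>x. x \<in> F \<Longrightarrow> wl x \<le> N"
        using finite_imageI[OF F(2), of wl] unfolding finite_nat_set_iff_bounded_le by blast
      have "sum m F = (\<Sum>n\<le>N. \<Sum>x\<in>{x \<in> F. wl x = n}. m x)"
        using N by (intro sum.group[symmetric] F(2)) auto
      also have "\<dots> \<le> (\<Sum>n\<le>N. real C * (1 / (1 + real n)\<^sup>2))"
      proof (rule sum_mono)
        fix n
        have "{x \<in> F. wl x = n} \<subseteq> words U n" using wl_mem F by blast
        then have "card {x \<in> F. wl x = n} \<le> C * (n + 1) ^ D"
          using CD[of n] card_mono[OF finite_words[OF U(2)]] le_trans by blast
        then have "real (card {x \<in> F. wl x = n}) \<le> real C * (1 + real n) ^ D"
          by (simp flip: of_nat_le_iff[where 'a = real] add: add.commute)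
        then have "real (card {x \<in> F. wl x = n}) * (1 / (1 + real n) ^ (D + 2))
            \<le> real C * (1 + real n) ^ D * (1 / (1 + real n) ^ (D + 2))"
          by (intro mult_right_mono) auto
        also have "\<dots> = real C * (1 / (1 + real n)\<^sup>2)" by (simp add: power_add power2_eq_square)
        finally show "(\<Sum>x\<in>{x \<in> F. wl x = n}. m x) \<le> real C * (1 / (1 + real n)\<^sup>2)"
          by (simp add: m_def)
      qed
      also have "\<dots> \<le> real C * (\<Sum>n. 1 / (1 + real n)\<^sup>2)"
        unfolding sum_distrib_left[symmetric]
        by (intro mult_left_mono sum_le_suminf sq) auto
      finally show "sum m F \<le> real C * (\<Sum>n. 1 / (1 + real n)\<^sup>2)" .
    qed
  qed (use m_pos in \<open>simp add: less_imp_le\<close>)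
  define M where "M = infsum m (carrier G)"
  have "m \<one> \<le> M"
    unfolding M_def using finite_sum_le_infsum[OF \<open>m summable_on carrier G\<close>, of "{\<one>}"] m_pos
    by (simp add: less_imp_le)
  then have M: "M > 0" using m_pos[of \<one>] by linarith
  define l where "l x = m x * (1 / M)" for x
  show ?thesis
  proof (rule that[of l])
    show "0 < l x" for x using M m_pos by (simp add: l_def)
    have "((\<lambda>x. m x * (1 / M)) has_sum M * (1 / M)) (carrier G)"
      unfolding M_def by (intro has_sum_cmult_left has_sum_infsum \<open>m summable_on carrier G\<close>)
    then show "(l has_sum 1) (carrier G)" using M by (simp add: l_def[abs_def])
    fix g and \<epsilon> :: real assume g: "g \<in> carrier G" and \<epsilon>: "\<epsilon> > 0"
    \<comment> \<open>The first summand bounds how much translation by \<open>g\<close> can lengthen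
      a word, the second how much it can shorten one.\<close>
    let ?k = "wl g + wl (inv g)"
    obtain N where N: "\<And>n m :: nat. N \<le> n \<Longrightarrow> n \<le> m + ?k \<Longrightarrow> m \<le> n + ?k \<Longrightarrow>
      \<bar>(((1 + real n) / (1 + real m)) ^ (D + 2))\<^sup>2 - 1\<bar> < \<epsilon>"
      using ratio_power_near_1[OF \<epsilon>, where k = ?k and p = "D + 2"] by blast
    have "wl x \<le> N" if x: "x \<in> carrier G" "\<epsilon> \<le> \<bar>(l (g \<otimes> x) / l x)\<^sup>2 - 1\<bar>" for x
    proof (rule ccontr)
      assume "\<not> wl x \<le> N"
      moreover have "wl x \<le> wl (g \<otimes> x) + ?k"
        using wl_mult[of "inv g" "g \<otimes> x"] g x by simp
      moreover have "wl (g \<otimes> x) \<le> wl x + ?k" using wl_mult[of g x] g x by simp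
      ultimately have "\<bar>(((1 + real (wl x)) / (1 + real (wl (g \<otimes> x)))) ^ (D + 2))\<^sup>2 - 1\<bar> < \<epsilon>"
        using N[of "wl x" "wl (g \<otimes> x)"] by simp
      moreover have "l (g \<otimes> x) / l x = ((1 + real (wl x)) / (1 + real (wl (g \<otimes> x)))) ^ (D + 2)"
        using M by (simp only: l_def m_def power_divide) simp
      ultimately show False using x(2) by simp
    qed
    then show "finite {x \<in> carrier G. \<epsilon> \<le> \<bar>(l (g \<otimes> x) / l x)\<^sup>2 - 1\<bar>}"
      by (intro finite_subset[OF _ ball[of N]]) blast
  qed
qed

end

theorem theorem1p2:
  fixes G :: "('a, 'b) monoid_scheme"
  assumes "group G"
    and "finitely_generated_group G"
    and "torsion_free_group G"
    and "nilpotent_group G"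
  shows "(\<exists>H. subgroup H Diff1_line \<and> G \<cong> Diff1_line \<lparr>carrier := H\<rparr>)
       \<and> (\<exists>H. subgroup H Diff1_circle \<and> G \<cong> Diff1_circle \<lparr>carrier := H\<rparr>)
       \<and> (\<exists>H. subgroup H Diff1_interval \<and> G \<cong> Diff1_interval \<lparr>carrier := H\<rparr>)"
proof -
  interpret group G by fact
  obtain P where P: "P \<subseteq> carrier G" "\<one>\<^bsub>G\<^esub> \<notin> P"
    "\<And>x y. x \<in> P \<Longrightarrow> y \<in> P \<Longrightarrow> x \<otimes>\<^bsub>G\<^esub> y \<in> P"
    "\<And>x. x \<in> carrier G \<Longrightarrow> x = \<one>\<^bsub>G\<^esub> \<or> x \<in> P \<or> inv\<^bsub>G\<^esub> x \<in> P"
    by (rule torsion_free_nilpotent_positive_cone[OF assms(3,4)]) (rule that)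
  obtain l :: "'a \<Rightarrow> real" where l: "\<And>x. x \<in> carrier G \<Longrightarrow> 0 < l x" "(l has_sum 1) (carrier G)"
    "\<And>g \<epsilon>. g \<in> carrier G \<Longrightarrow> \<epsilon> > 0 \<Longrightarrow>
      finite {x \<in> carrier G. \<epsilon> \<le> \<bar>(l (g \<otimes>\<^bsub>G\<^esub> x) / l x)\<^sup>2 - 1\<bar>}"
    by (rule nilpotent_summable_weight[OF assms(2,4)]) (rule that)
  \<comment> \<open>Left-invariant, since \<open>g\<close> cancels in the inverse of
    \<open>g x\<close> times \<open>g y\<close>.\<close>
  define lt where "lt x y \<longleftrightarrow> inv\<^bsub>G\<^esub> x \<otimes>\<^bsub>G\<^esub> y \<in> P" for x y
  interpret W: weighted_order "carrier G" lt l
  proof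
    fix x y z assume x: "x \<in> carrier G"
    show "\<not> lt x x" using x P(2) by (simp add: lt_def)
    assume y: "y \<in> carrier G"
    show "lt x y \<or> lt y x" if "x \<noteq> y"
    proof -
      have "inv\<^bsub>G\<^esub> (inv\<^bsub>G\<^esub> x \<otimes>\<^bsub>G\<^esub> y) = inv\<^bsub>G\<^esub> y \<otimes>\<^bsub>G\<^esub> x" using x y by (simp add: inv_mult_group)
      moreover have "inv\<^bsub>G\<^esub> x \<otimes>\<^bsub>G\<^esub> y \<noteq> \<one>\<^bsub>G\<^esub>"
        using that x y inv_equality[of "inv\<^bsub>G\<^esub> x" y] by (metis inv_closed inv_inv inv_comm inv_equality)
      ultimately show ?thesis using P(4)[of "inv\<^bsub>G\<^esub> x \<otimes>\<^bsub>G\<^esub> y"] x y by (simp add: lt_def)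
    qed
    assume z: "z \<in> carrier G"
    show "lt x z" if "lt x y" "lt y z"
      using P(3)[of "inv\<^bsub>G\<^esub> x \<otimes>\<^bsub>G\<^esub> y" "inv\<^bsub>G\<^esub> y \<otimes>\<^bsub>G\<^esub> z"] that x y z by (simp add: lt_def m_assoc)
  qed (use l in auto)
  have slow: "W.slow_automorphism (\<lambda>x. g \<otimes>\<^bsub>G\<^esub> x)" if g: "g \<in> carrier G" for g
    unfolding W.slow_automorphism_def
  proof (intro conjI ballI impI allI)
    show "bij_betw (\<lambda>x. g \<otimes>\<^bsub>G\<^esub> x) (carrier G) (carrier G)"
      by (rule bij_betw_byWitness[where f' = "\<lambda>x. inv\<^bsub>G\<^esub> g \<otimes>\<^bsub>G\<^esub> x"]) (use g in auto)
    show "lt (g \<otimes>\<^bsub>G\<^esub> x) (g \<otimes>\<^bsub>G\<^esub> y)" if "x \<in> carrier G" "y \<in> carrier G" "lt x y" for x y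
      using that g by (simp add: lt_def inv_mult_group m_assoc)
  qed (use l(3) g in blast)
  interpret A: unit_interval_action G "\<lambda>g. W.blowup (\<lambda>x. g \<otimes>\<^bsub>G\<^esub> x)"
  proof
    show "W.blowup (\<lambda>x. \<one>\<^bsub>G\<^esub> \<otimes>\<^bsub>G\<^esub> x) t = t" for t by (rule W.blowup_id) simp
    fix g t assume g: "g \<in> carrier G"
    show "W.blowup (\<lambda>x. (g \<otimes>\<^bsub>G\<^esub> h) \<otimes>\<^bsub>G\<^esub> x) t = W.blowup (\<lambda>x. g \<otimes>\<^bsub>G\<^esub> x) (W.blowup (\<lambda>x. h \<otimes>\<^bsub>G\<^esub> x) t)"
      if "h \<in> carrier G" for h
      using g that by (intro W.blowup_compose[symmetric] slow) (auto simp: m_assoc)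
    show "\<exists>D. continuous_on UNIV D \<and> (\<forall>t. 0 < D t)
        \<and> (\<forall>t. (W.blowup (\<lambda>x. g \<otimes>\<^bsub>G\<^esub> x) has_real_derivative D t) (at t))"
      using W.blowup_C1[OF slow[OF g]] by metis
    show "W.blowup (\<lambda>x. g \<otimes>\<^bsub>G\<^esub> x) t = t" if "t \<le> 0 \<or> 1 \<le> t"
      by (rule W.blowup_outside[OF slow[OF g] that])
    show "0 \<le> W.blowup (\<lambda>x. g \<otimes>\<^bsub>G\<^esub> x) t \<and> W.blowup (\<lambda>x. g \<otimes>\<^bsub>G\<^esub> x) t \<le> 1" if "0 \<le> t" "t \<le> 1"
      using W.blowup_range[OF slow[OF g] that] by blast
    show "g = h" if h: "h \<in> carrier G" and eq: "W.blowup (\<lambda>x. g \<otimes>\<^bsub>G\<^esub> x) = W.blowup (\<lambda>x. h \<otimes>\<^bsub>G\<^esub> x)" for h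
      \<comment> \<open>Left translations are told apart by the image of
        \<open>\<one>\<close>.\<close>
      using W.blowup_inject[OF slow[OF g] slow[OF h] eq one_closed] g h by simp
  qed
  show ?thesis
    using A.embeds_Diff1_real[OF subset_UNIV UNIV_I group_Diff1_line] A.embeds_Diff1_circle
      A.embeds_Diff1_real[OF order_refl _ group_Diff1_interval] A.act_range
    by simp
qed

end
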